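(* Let $n\ge 1$ and let $\alpha_1\ge\dots\ge\alpha_n\ge 0$ be ordinals, and $X=\omega^{\alpha_1}\times\dots\times\omega^{\alpha_n}$. If $\alpha_2=\dots=\alpha_n=0$ (in particular if $n=1$), then $\mathbf{w}(X)=1$; otherwise $\mathbf{w}(X)=\omega^{\alpha_1\oplus((\alpha_2\oplus\dots\oplus\alpha_n)-1)}$.
   Context: $X$ has the componentwise order. The width $\mathbf{w}(A)$ of a wqo $A$ is the rank of the forest of nonempty finite sequences of pairwise incomparable elements of $A$ ordered by initial segment. $\oplus$ is the natural (Hessenberg) sum. For ordinals $\beta\le\gamma$, $\gamma-\beta$ denotes the unique $\delta$ with $\beta+\delta=\gamma$. *)

theory Defs
  imports Main "HOL-Library.Sublist"
begin

text \<open>An ordinal is represented by a well-order relation (reflexive, non-strict),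
compared up to order isomorphism with ordIso and ordLeq from Main.\<close>

definition omega_pow_carrier :: "'a rel \<Rightarrow> ('a \<Rightarrow> nat) set" where
  "omega_pow_carrier \<alpha> = {f. finite {x. f x \<noteq> 0} \<and> (\<forall>x. x \<notin> Field \<alpha> \<longrightarrow> f x = 0)}"

definition omega_pow :: "'a rel \<Rightarrow> ('a \<Rightarrow> nat) rel" where
  "omega_pow \<alpha> = {(f, g). f \<in> omega_pow_carrier \<alpha> \<and> g \<in> omega_pow_carrier \<alpha> \<and>
      (f = g \<or> (\<exists>x\<in>Field \<alpha>. f x < g x \<and>
                  (\<forall>y\<in>Field \<alpha>. (x, y) \<in> \<alpha> \<and> y \<noteq> x \<longrightarrow> f y = g y)))}"

definition ord_one :: "unit rel" where
  "ord_one = {((), ())}"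

definition ord_sum :: "'a rel \<Rightarrow> 'b rel \<Rightarrow> ('a + 'b) rel" where
  "ord_sum r s = {(Inl a, Inl b) | a b. (a, b) \<in> r} \<union> {(Inr a, Inr b) | a b. (a, b) \<in> s}
              \<union> {(Inl a, Inr b) | a b. a \<in> Field r \<and> b \<in> Field s}"

definition ord_list_sum :: "'a rel list \<Rightarrow> (nat \<times> 'a) rel" where
  "ord_list_sum rs = {((i, x), (j, y)). i < length rs \<and> j < length rs \<and>
      x \<in> Field (rs ! i) \<and> y \<in> Field (rs ! j) \<and> (i < j \<or> (i = j \<and> (x, y) \<in> rs ! i))}"

definition nonincreasing_ords :: "'a rel list \<Rightarrow> bool" where
  "nonincreasing_ords ks \<longleftrightarrow> (\<forall>i j. i < j \<and> j < length ks \<longrightarrow> (ks ! j, ks ! i) \<in> ordLeq)"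

definition is_cnf :: "'a rel \<Rightarrow> 'a rel list \<Rightarrow> bool" where
  "is_cnf \<alpha> ks \<longleftrightarrow> (\<forall>k\<in>set ks. Well_order k) \<and> nonincreasing_ords ks \<and>
      (\<alpha>, ord_list_sum (map omega_pow ks)) \<in> ordIso"

definition ord_rearrangement :: "'b rel list \<Rightarrow> 'a rel list \<Rightarrow> bool" where
  "ord_rearrangement ms ks \<longleftrightarrow> (\<exists>\<pi>. bij_betw \<pi> {..<length ms} {..<length ks} \<and>
      (\<forall>i<length ms. (ms ! i, ks ! (\<pi> i)) \<in> ordIso))"

definition is_nat_sum :: "'a rel list \<Rightarrow> 'b rel \<Rightarrow> bool" where
  "is_nat_sum as \<gamma> \<longleftrightarrow> (\<exists>kss ms. length kss = length as \<and>
      (\<forall>i<length as. is_cnf (as ! i) (kss ! i)) \<and> is_cnf \<gamma> ms \<and>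
      ord_rearrangement ms (concat kss))"

text \<open>Binary natural sum (summands may live on different types).\<close>
definition is_nat_sum2 :: "'a rel \<Rightarrow> 'b rel \<Rightarrow> 'c rel \<Rightarrow> bool" where
  "is_nat_sum2 \<alpha> \<beta> \<gamma> \<longleftrightarrow>
     is_nat_sum [map_prod Inl Inl ` \<alpha>, map_prod Inr Inr ` \<beta>] \<gamma>"

definition antichain_seqs :: "'x set \<Rightarrow> ('x \<Rightarrow> 'x \<Rightarrow> bool) \<Rightarrow> 'x list set" where
  "antichain_seqs A le = {s. s \<noteq> [] \<and> set s \<subseteq> A \<and>
      (\<forall>i<length s. \<forall>j<length s. i \<noteq> j \<longrightarrow> \<not> le (s ! i) (s ! j))}"

text \<open>The forest T (ordered by initial segment; children of s are its proper
extensions) has rank gamma: there is a rank function rho from T onto Field gamma with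
rho s = the least element above rho t for all proper extensions t of s, i.e.
rho s = sup (rho t + 1). The rank of the forest is then the order type of the
image, i.e. sup (rho s + 1) over s in T.\<close>
definition forest_rank :: "'x list set \<Rightarrow> 'g rel \<Rightarrow> bool" where
  "forest_rank T \<gamma> \<longleftrightarrow> Well_order \<gamma> \<and> (\<exists>\<rho>. \<rho> ` T = Field \<gamma> \<and>
      (\<forall>s\<in>T.
         (\<forall>t\<in>T. strict_prefix s t \<longrightarrow> (\<rho> t, \<rho> s) \<in> \<gamma> \<and> \<rho> t \<noteq> \<rho> s) \<and>
         (\<forall>c\<in>Field \<gamma>. (\<forall>t\<in>T. strict_prefix s t \<longrightarrow> (\<rho> t, c) \<in> \<gamma> \<and> \<rho> t \<noteq> c)
              \<longrightarrow> (\<rho> s, c) \<in> \<gamma>)))"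

definition width_is :: "'x set \<Rightarrow> ('x \<Rightarrow> 'x \<Rightarrow> bool) \<Rightarrow> 'g rel \<Rightarrow> bool" where
  "width_is A le \<gamma> \<longleftrightarrow> forest_rank (antichain_seqs A le) \<gamma>"

definition prod_carrier :: "'a rel list \<Rightarrow> 'a list set" where
  "prod_carrier Ws = {xs. length xs = length Ws \<and> (\<forall>i<length Ws. xs ! i \<in> Field (Ws ! i))}"

definition prod_le :: "'a rel list \<Rightarrow> 'a list \<Rightarrow> 'a list \<Rightarrow> bool" where
  "prod_le Ws xs ys \<longleftrightarrow> (\<forall>i<length Ws. (xs ! i, ys ! i) \<in> Ws ! i)"

end

theory Submission
  imports Defs "HOL-Library.Multiset_Order"
begin

text \<open>An ordinal in Cantor normal form is the finite multiset of its exponents, compared by the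
  multiset order; the natural sum is the multiset union.

  Let \<open>a = (a\<^sub>1, \<dots>, a\<^sub>n)\<close> and let \<open>f(a)\<close> be the exponent claimed for the width.

  Upper bound: an element incomparable to \<open>x\<close> is smaller than \<open>x\<close> in some coordinate \<open>i\<close>, hence lies in one of
  finitely many translates of boxes \<open>a[i := c]\<close> with \<open>c < a\<^sub>i\<close>, and \<open>f(a[i := c]) < f(a)\<close>. Playing an
  antichain thus replaces a box by finitely many boxes of smaller exponent, and the multiset of
  exponents decreases in \<open>\<omega>\<^bsup>f(a)\<^esup>\<close>.

  Lower bound: for every \<open>e < f(a)\<close> there are \<open>i\<close> and \<open>c < a\<^sub>i\<close> with \<open>e \<le> f(a[i := c])\<close>. Split
  coordinate \<open>i\<close> into slabs \<open>[\<omega>\<^sup>c m, \<omega>\<^sup>c (m + 1))\<close> for \<open>m < k\<close>, and play in the slabs from the top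
  down, each time raising another nonzero coordinate above everything played so far. Elements of
  different slabs are incomparable, so the width is at least \<open>\<omega>\<^sup>e k\<close> for every \<open>k\<close>.\<close>

section \<open>Width as the rank of residuals\<close>

definition incomparable :: "('x \<Rightarrow> 'x \<Rightarrow> bool) \<Rightarrow> 'x \<Rightarrow> 'x \<Rightarrow> bool" where
  "incomparable le x y \<longleftrightarrow> \<not> le x y \<and> \<not> le y x"

definition residual :: "('x \<Rightarrow> 'x \<Rightarrow> bool) \<Rightarrow> 'x set \<Rightarrow> 'x list \<Rightarrow> 'x set" where
  "residual le A s = {y \<in> A. \<forall>x \<in> set s. incomparable le x y}"

text \<open>\<open>width_le le A \<zeta>\<close> and \<open>width_ge le A \<zeta>\<close> bound the
  rank of the forest of antichain sequences in \<open>A\<close> from above and from below. As two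
  separate predicates they allow each bound to be proved alone, in any wellorder type, before the
  rank is known to exist there.\<close>

inductive width_le :: "('x \<Rightarrow> 'x \<Rightarrow> bool) \<Rightarrow> 'x set \<Rightarrow> 'o::wellorder \<Rightarrow> bool" for le where
  width_leI: "(\<And>x. x \<in> A \<Longrightarrow> \<exists>\<xi><\<zeta>. width_le le (residual le A [x]) \<xi>) \<Longrightarrow> width_le le A \<zeta>"

inductive width_ge :: "('x \<Rightarrow> 'x \<Rightarrow> bool) \<Rightarrow> 'x set \<Rightarrow> 'o::wellorder \<Rightarrow> bool" for le where
  width_geI: "(\<And>\<xi>. \<xi> < \<zeta> \<Longrightarrow> \<exists>x\<in>A. width_ge le (residual le A [x]) \<xi>) \<Longrightarrow> width_ge le A \<zeta>"

text \<open>The value is meaningful only once some upper bound exists in the type \<open>'o\<close>;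
  the lemmas about \<open>width\<close> therefore assume a \<open>width_le\<close>.\<close>

definition width :: "('x \<Rightarrow> 'x \<Rightarrow> bool) \<Rightarrow> 'x set \<Rightarrow> 'o::wellorder" where
  "width le A = (LEAST \<zeta>. width_le le A \<zeta>)"

lemma width_leD: "width_le le A \<zeta> \<Longrightarrow> x \<in> A \<Longrightarrow> \<exists>\<xi><\<zeta>. width_le le (residual le A [x]) \<xi>"
  by (auto elim: width_le.cases)

lemma width_geD: "width_ge le A \<zeta> \<Longrightarrow> \<xi> < \<zeta> \<Longrightarrow> \<exists>x\<in>A. width_ge le (residual le A [x]) \<xi>"
  by (auto elim: width_ge.cases)

lemma residual_mono: "A \<subseteq> B \<Longrightarrow> residual le A s \<subseteq> residual le B s"
  by (auto simp: residual_def)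

lemma residual_append: "residual le (residual le A s) t = residual le A (s @ t)"
  by (auto simp: residual_def)

text \<open>Since \<open>h\<close> preserves incomparability, it carries every play in
  \<open>A\<close> to a play in \<open>B\<close>, so an upper bound for \<open>B\<close> serves for
  \<open>A\<close>. The identity gives subsets; coordinatewise order types later give the
  product.\<close>

lemma width_le_image:
  assumes "width_le le' B \<zeta>" "\<And>x. x \<in> A \<Longrightarrow> h x \<in> B"
    "\<And>x y. x \<in> A \<Longrightarrow> y \<in> A \<Longrightarrow> incomparable le x y \<Longrightarrow> incomparable le' (h x) (h y)"
  shows "width_le le A \<zeta>"
  using assms
proof (induction \<zeta> arbitrary: A B rule: less_induct)
  case (less \<zeta>)
  show ?case
  proof (rule width_leI)
    fix x assume x: "x \<in> A"
    then obtain \<xi> where \<xi>: "\<xi> < \<zeta>" "width_le le' (residual le' B [h x]) \<xi>"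
      using width_leD[OF less.prems(1)] less.prems(2) by blast
    have "width_le le (residual le A [x]) \<xi>"
      by (rule less.IH[OF \<xi>]) (use x less.prems(2,3) in \<open>auto simp: residual_def\<close>)
    then show "\<exists>\<xi><\<zeta>. width_le le (residual le A [x]) \<xi>" using \<xi> by blast
  qed
qed

lemma width_le_subset: "width_le le B \<zeta> \<Longrightarrow> A \<subseteq> B \<Longrightarrow> width_le le A \<zeta>"
  by (erule width_le_image[where h = "\<lambda>x. x"]) auto

lemma width_ge_mono: "width_ge le A \<zeta> \<Longrightarrow> \<xi> \<le> \<zeta> \<Longrightarrow> width_ge le A \<xi>"
  by (rule width_geI) (meson order.strict_trans2 width_geD)

lemma width_ge_image:
  assumes "width_ge le A \<zeta>" "\<And>x. x \<in> A \<Longrightarrow> h x \<in> B"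
    "\<And>x y. x \<in> A \<Longrightarrow> y \<in> A \<Longrightarrow> incomparable le x y \<Longrightarrow> incomparable le' (h x) (h y)"
  shows "width_ge le' B \<zeta>"
  using assms
proof (induction \<zeta> arbitrary: A B rule: less_induct)
  case (less \<zeta>)
  show ?case
  proof (rule width_geI)
    fix \<xi> assume \<xi>: "\<xi> < \<zeta>"
    then obtain x where x: "x \<in> A" "width_ge le (residual le A [x]) \<xi>"
      using width_geD[OF less.prems(1)] by blast
    have "width_ge le' (residual le' B [h x]) \<xi>"
      by (rule less.IH[OF \<xi> x(2)]) (use x less.prems(2,3) in \<open>auto simp: residual_def\<close>)
    then show "\<exists>x\<in>B. width_ge le' (residual le' B [x]) \<xi>"
      using x less.prems(2) by blast
  qed
qed

lemma width_ge_subset: "width_ge le A \<zeta> \<Longrightarrow> A \<subseteq> B \<Longrightarrow> width_ge le B \<zeta>"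
  by (erule width_ge_image[where h = "\<lambda>x. x"]) auto

text \<open>If \<open>\<eta> < \<zeta>\<close>, the lower bound supplies an \<open>x\<close> whose
  residual still has rank at least \<open>\<eta>\<close>, while the upper bound puts that residual
  below \<open>\<eta>\<close>; descend.\<close>

lemma width_ge_le: "width_ge le A \<zeta> \<Longrightarrow> width_le le A \<eta> \<Longrightarrow> \<zeta> \<le> \<eta>"
proof (induction \<eta> arbitrary: A \<zeta> rule: less_induct)
  case (less \<eta>)
  show ?case
  proof (rule ccontr)
    assume "\<not> \<zeta> \<le> \<eta>"
    then have "\<eta> < \<zeta>" by simp
    then obtain x where x: "x \<in> A" "width_ge le (residual le A [x]) \<eta>"
      using width_geD[OF less.prems(1)] by blast
    then obtain \<xi> where "\<xi> < \<eta>" "width_le le (residual le A [x]) \<xi>"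
      using width_leD[OF less.prems(2)] by blast
    with less.IH x(2) show False by fastforce
  qed
qed

lemma width_le_width: "width_le le A (\<zeta>::'o::wellorder) \<Longrightarrow> width_le le A (width le A :: 'o)"
  unfolding width_def by (rule LeastI)

lemma width_eqI:
  assumes "width_ge le A \<zeta>" "width_le le A \<zeta>"
  shows "width le A = \<zeta>"
  unfolding width_def using assms by (intro Least_equality) (auto intro: width_ge_le)

lemma width_residual_less:
  assumes "width_le le A (\<zeta>::'o::wellorder)" "x \<in> A"
  shows "(width le (residual le A [x]) :: 'o) < width le A"
proof -
  obtain \<xi> :: 'o where "\<xi> < width le A" "width_le le (residual le A [x]) \<xi>"
    using width_leD[OF width_le_width[OF assms(1)] assms(2)] by blast
  then show ?thesis
    unfolding width_def[of le "residual le A [x]"] by (meson Least_le order.strict_trans1)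
qed

lemma width_mono:
  assumes "width_le le B (\<zeta>::'o::wellorder)" "A \<subseteq> B"
  shows "(width le A :: 'o) \<le> width le B"
  unfolding width_def[of le A]
  by (rule Least_le) (rule width_le_subset[OF width_le_width[OF assms(1)] assms(2)])

text \<open>Otherwise all residuals have width below \<open>\<zeta>\<close>, so
  \<open>\<zeta>\<close> would already be an upper bound, against minimality.\<close>

lemma ex_width_residual_ge:
  assumes "width_le le A (\<eta>::'o::wellorder)" "(\<zeta>::'o) < width le A"
  shows "\<exists>x\<in>A. \<zeta> \<le> width le (residual le A [x])"
proof (rule ccontr)
  assume *: "\<not> ?thesis"
  have "width_le le A \<zeta>"
  proof (rule width_leI)
    fix x assume x: "x \<in> A"
    have "width_le le (residual le A [x]) (width le (residual le A [x]) :: 'o)"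
      by (rule width_le_width[OF width_le_subset[OF assms(1)]]) (auto simp: residual_def)
    with * x show "\<exists>\<xi><\<zeta>. width_le le (residual le A [x]) \<xi>" by force
  qed
  then have "width le A \<le> \<zeta>" unfolding width_def by (rule Least_le)
  with assms(2) show False by simp
qed

text \<open>Children of a node are the elements of its residual. The case \<open>s = []\<close> is
  separate because \<open>antichain_seqs\<close> excludes the empty sequence, the virtual root above
  the forest.\<close>

lemma antichain_seqs_snoc_iff:
  "s @ [x] \<in> antichain_seqs A le \<longleftrightarrow>
     (s = [] \<or> s \<in> antichain_seqs A le) \<and> x \<in> residual le A s"
  (is "?l \<longleftrightarrow> ?r")
proof
  assume l: ?l
  then have inc: "\<not> le ((s @ [x]) ! i) ((s @ [x]) ! j)" if "i < Suc (length s)" "j < Suc (length s)" "i \<noteq> j" for i j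
    using that by (simp add: antichain_seqs_def)
  have "\<not> le (s ! i) (s ! j)" if "i < length s" "j < length s" "i \<noteq> j" for i j
    using inc[of i j] that by (simp add: nth_append)
  moreover have "incomparable le z x" if z: "z \<in> set s" for z
  proof -
    obtain i where "i < length s" "z = s ! i" using z unfolding in_set_conv_nth by blast
    then show ?thesis using inc[of i "length s"] inc[of "length s" i]
      by (simp add: nth_append incomparable_def)
  qed
  ultimately show ?r using l by (auto simp: antichain_seqs_def residual_def)
next
  assume ?r
  then show ?l
    by (auto simp: antichain_seqs_def residual_def incomparable_def nth_append less_Suc_eq)
qed

text \<open>A proper extension of \<open>s\<close> passes through a child \<open>s @ [x]\<close>,
  and further moves only shrink the residual; this reduces proper extensions to single
  moves.\<close>

lemma antichain_seqs_strict_prefix: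
  assumes "strict_prefix s t" "t \<in> antichain_seqs A le"
  obtains x where "x \<in> residual le A s" "residual le A t \<subseteq> residual le A (s @ [x])"
proof -
  obtain x u where t: "t = s @ x # u" using assms(1) by (rule strict_prefixE')
  have "(s @ [x]) @ u \<in> antichain_seqs A le \<Longrightarrow> s @ [x] \<in> antichain_seqs A le"
  proof (induction u rule: rev_induct)
    case (snoc y u)
    then show ?case using antichain_seqs_snoc_iff[of "(s @ [x]) @ u" y A le] by auto
  qed simp
  then have "s @ [x] \<in> antichain_seqs A le" using assms(2) t by simp
  then have "x \<in> residual le A s" by (simp add: antichain_seqs_snoc_iff)
  moreover have "residual le A t \<subseteq> residual le A (s @ [x])" by (auto simp: t residual_def)
  ultimately show ?thesis using that by blast
qed

text \<open>Ranks skip no value: move to a child whose width is still at least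
  \<open>\<zeta>\<close>. Widths strictly decrease along the way, so \<open>\<zeta>\<close> itself
  is hit.\<close>

lemma ex_antichain_seq_width_eq:
  assumes "width_le le A (\<eta>::'o::wellorder)" "s = [] \<or> s \<in> antichain_seqs A le"
    "(\<zeta>::'o) < width le (residual le A s)"
  shows "\<exists>t\<in>antichain_seqs A le. width le (residual le A t) = \<zeta>"
  using assms(2,3)
proof (induction "width le (residual le A s) :: 'o" arbitrary: s rule: less_induct)
  case less
  have wle: "width_le le (residual le A s) \<eta>"
    by (rule width_le_subset[OF assms(1)]) (auto simp: residual_def)
  obtain x where x: "x \<in> residual le A s" "\<zeta> \<le> width le (residual le A (s @ [x]))"
    using ex_width_residual_ge[OF wle less.prems(2)] by (auto simp: residual_append)
  have sx: "s @ [x] \<in> antichain_seqs A le"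
    using less.prems x by (simp add: antichain_seqs_snoc_iff)
  have "(width le (residual le A (s @ [x])) :: 'o) < width le (residual le A s)"
    using width_residual_less[OF wle x(1)] by (simp add: residual_append)
  then show ?case using less.hyps[of "s @ [x]"] sx x(2) by (cases "\<zeta> = width le (residual le A (s @ [x]))") auto
qed

text \<open>The rank function demanded by \<open>forest_rank\<close> sends \<open>s\<close> to the
  width of the residual after \<open>s\<close>, transported to \<open>Field r\<close> by the inverse
  of \<open>h\<close>.\<close>

lemma forest_rank_antichain_seqs:
  fixes \<zeta> :: "'o::wellorder" and r :: "'g rel"
  assumes ge: "width_ge le A \<zeta>" and le: "width_le le A \<zeta>"
    and wo: "Well_order r" and bij: "bij_betw h (Field r) {..<\<zeta>}"
    and iff: "\<And>x y. x \<in> Field r \<Longrightarrow> y \<in> Field r \<Longrightarrow> (x, y) \<in> r \<longleftrightarrow> h x \<le> h y"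
  shows "width_is A le r"
proof -
  let ?T = "antichain_seqs A le"
  define rk :: "'a list \<Rightarrow> 'o" where "rk s = width le (residual le A s)" for s
  \<comment> \<open>The virtual root has value \<open>\<zeta>\<close>; the forest itself fills
    exactly the values below it.\<close>
  have wA: "rk [] = \<zeta>" using width_eqI[OF ge le] by (simp add: rk_def residual_def)
  have wle: "width_le le (residual le A s) \<zeta>" for s
    by (rule width_le_subset[OF le]) (auto simp: residual_def)
  have dec: "rk t < rk s" if "strict_prefix s t" "t \<in> ?T" for s t
  proof -
    obtain x where x: "x \<in> residual le A s" "residual le A t \<subseteq> residual le A (s @ [x])"
      by (rule antichain_seqs_strict_prefix[OF \<open>strict_prefix s t\<close> \<open>t \<in> ?T\<close>])
    have "rk t \<le> rk (s @ [x])" unfolding rk_def by (rule width_mono[OF wle x(2)])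
    also have "\<dots> < rk s" using width_residual_less[OF wle x(1)] by (simp add: rk_def residual_append)
    finally show ?thesis .
  qed
  have rk_img: "rk ` ?T = {..<\<zeta>}"
  proof (intro equalityI subsetI)
    fix c assume "c \<in> rk ` ?T"
    then obtain s where s: "s \<in> ?T" "c = rk s" by blast
    then have "strict_prefix [] s" by (auto simp: antichain_seqs_def strict_prefix_def)
    then show "c \<in> {..<\<zeta>}" using dec[of "[]" s] s wA by simp
  next
    fix c assume "c \<in> {..<\<zeta>}"
    then show "c \<in> rk ` ?T"
      using ex_antichain_seq_width_eq[OF le, of "[]" c] wA by (force simp: rk_def)
  qed
  have least: "rk s \<le> c" if s: "s \<in> ?T" and c: "\<And>t. t \<in> ?T \<Longrightarrow> strict_prefix s t \<Longrightarrow> rk t < c" for s c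
  proof (rule ccontr)
    assume "\<not> rk s \<le> c"
    then have "c < width le (residual le A s)" by (simp add: rk_def)
    then obtain x where x: "x \<in> residual le A s" "c \<le> rk (s @ [x])"
      using ex_width_residual_ge[OF wle[of s]] unfolding rk_def residual_append by blast
    have "s @ [x] \<in> ?T" using s x by (simp add: antichain_seqs_snoc_iff)
    then show False using c[of "s @ [x]"] x(2) by (auto simp: strict_prefix_def)
  qed
  define g where "g = inv_into (Field r) h"
  have g: "g c \<in> Field r" "h (g c) = c" if "c < \<zeta>" for c
    using that bij by (auto simp: g_def bij_betw_def intro!: inv_into_into f_inv_into_f)
  have gh: "g (h x) = x" if "x \<in> Field r" for x
    using that bij by (auto simp: g_def bij_betw_def)
  have hx: "h x < \<zeta>" if "x \<in> Field r" for x using bij that by (auto simp: bij_betw_def)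
  have rkT: "rk s < \<zeta>" if "s \<in> ?T" for s using rk_img that by auto
  show ?thesis
    unfolding width_is_def forest_rank_def
  proof (intro conjI wo exI[of _ "g \<circ> rk"] ballI impI)
    have "g ` {..<\<zeta>} = Field r" using g(1) gh hx by (force simp: image_iff)
    then show "(g \<circ> rk) ` ?T = Field r" by (simp only: image_comp[symmetric] rk_img)
  next
    fix s t assume s: "s \<in> ?T" "t \<in> ?T" "strict_prefix s t"
    then show "((g \<circ> rk) t, (g \<circ> rk) s) \<in> r" "(g \<circ> rk) t \<noteq> (g \<circ> rk) s"
      using dec[of s t] iff[of "g (rk t)" "g (rk s)"] g[OF rkT[OF s(1)]] g[OF rkT[OF s(2)]] by auto
  next
    fix s c assume s: "s \<in> ?T" and c: "c \<in> Field r"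
      "\<forall>t\<in>?T. strict_prefix s t \<longrightarrow> ((g \<circ> rk) t, c) \<in> r \<and> (g \<circ> rk) t \<noteq> c"
    have "rk s \<le> h c"
    proof (rule least[OF s])
      fix t assume t: "t \<in> ?T" "strict_prefix s t"
      then have "(g (rk t), c) \<in> r" "g (rk t) \<noteq> c" using c(2) by auto
      then have "rk t \<le> h c" "rk t \<noteq> h c"
        using iff[of "g (rk t)" c] g[OF rkT[OF t(1)]] c(1) gh[OF c(1)] by auto
      then show "rk t < h c" by (rule order.not_eq_order_implies_strict[rotated])
    qed
    then show "((g \<circ> rk) s, c) \<in> r" using iff[of "g (rk s)" c] g[OF rkT[OF s]] c(1) by simp
  qed
qed

section \<open>Ordinals as multisets of exponents\<close>

text \<open>Over a linear order the multiset order is decided at the largest exponent whose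
  multiplicities differ, exactly as Cantor normal forms are compared.\<close>

lemma less_multiset_iff_top:
  fixes M N :: "'a::linorder multiset"
  shows "M < N \<longleftrightarrow> (\<exists>c. count M c < count N c \<and> (\<forall>x>c. count M x = count N x))"
proof
  assume l: "M < N"
  define D where "D = {x. count M x \<noteq> count N x}"
  have "D \<subseteq> set_mset M \<union> set_mset N" by (auto simp: D_def count_eq_zero_iff) (metis count_inI)
  then have fin: "finite D" by (rule finite_subset) auto
  have "M \<noteq> N" using l by blast
  then have "D \<noteq> {}" by (auto simp: D_def multiset_eq_iff)
  then have c: "Max D \<in> D" "\<And>x. x > Max D \<Longrightarrow> x \<notin> D" using fin by auto
  have "\<not> count N (Max D) < count M (Max D)"
  proof
    assume "count N (Max D) < count M (Max D)"
    then obtain x where "x > Max D" "count M x < count N x"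
      using l unfolding less_multiset\<^sub>H\<^sub>O by blast
    then show False using c(2)[of x] by (simp add: D_def)
  qed
  then show "\<exists>c. count M c < count N c \<and> (\<forall>x>c. count M x = count N x)"
    using c unfolding D_def mem_Collect_eq by (metis linorder_neqE_nat)
next
  assume "\<exists>c. count M c < count N c \<and> (\<forall>x>c. count M x = count N x)"
  then obtain c where "count M c < count N c" "\<And>x. x > c \<Longrightarrow> count M x = count N x" by blast
  then show "M < N"
    unfolding less_multiset\<^sub>H\<^sub>O by (metis less_irrefl_nat less_imp_not_less linorder_neqE)
qed

text \<open>\<open>M\<close> agrees with \<open>N\<close> above the top exponent \<open>c\<close> of
  difference and has fewer copies of \<open>c\<close>; \<open>q\<close> collects the terms of
  \<open>M\<close> from \<open>c\<close> upwards. For fixed \<open>N\<close> only finitely many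
  pairs \<open>(c, q)\<close> occur, which makes the covering in the upper bound finite.\<close>

lemma less_multiset_prefixE:
  fixes M N :: "'a::linorder multiset"
  assumes "M < N"
  obtains c q z where "c \<in># N" "q \<subseteq># N" "M = q + z" "z < {#c#}"
proof -
  obtain c where c: "count M c < count N c" "\<And>x. x > c \<Longrightarrow> count M x = count N x"
    using assms unfolding less_multiset_iff_top by blast
  show ?thesis
  proof (rule that[of c "filter_mset (\<lambda>x. c \<le> x) M" "filter_mset (\<lambda>x. \<not> c \<le> x) M"])
    show "c \<in># N" using c(1) by (simp add: count_greater_zero_iff[symmetric] del: count_greater_zero_iff)
    show "filter_mset (\<lambda>x. c \<le> x) M \<subseteq># N"
      using c by (auto simp: subseteq_mset_def le_less)
    show "M = filter_mset (\<lambda>x. c \<le> x) M + filter_mset (\<lambda>x. \<not> c \<le> x) M" by simp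
  qed auto
qed

text \<open>Throughout, \<open>{#a#}\<close> stands for the ordinal \<open>\<omega>\<^sup>a\<close>: the multisets below it are those all of
  whose elements are below \<open>a\<close>.\<close>

definition box :: "'o::wellorder list \<Rightarrow> 'o multiset list set" where
  "box a = {xs. length xs = length a \<and> (\<forall>i<length a. xs ! i < {#a ! i#})}"

text \<open>The translate of \<open>box b\<close> by \<open>p\<close>. Addition is multiset union,
  that is, the natural sum; it is strictly monotone, so a translate keeps the order of the
  box.\<close>

definition cell :: "'o::wellorder multiset list \<Rightarrow> 'o list \<Rightarrow> 'o multiset list set" where
  "cell p b = {xs. length p = length b \<and> length xs = length b \<and>
     (\<forall>i<length b. \<exists>z<{#b ! i#}. xs ! i = p ! i + z)}"

text \<open>The exponent 0: \<open>{#}\<close> is the ordinal 0, \<open>{#zero_exp#}\<close> is 1,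
  and the natural numbers are the multisets with no other exponent.\<close>

definition zero_exp :: "'k::wellorder" where
  "zero_exp = (LEAST x. True)"

definition fin_ord :: "'k::wellorder multiset \<Rightarrow> bool" where
  "fin_ord a \<longleftrightarrow> set_mset a \<subseteq> {zero_exp}"

definition two_nonzero :: "'k multiset list \<Rightarrow> bool" where
  "two_nonzero a \<longleftrightarrow> (\<exists>i<length a. \<exists>j<length a. i \<noteq> j \<and> a ! i \<noteq> {#} \<and> a ! j \<noteq> {#})"

definition two_infinite :: "'k::wellorder multiset list \<Rightarrow> bool" where
  "two_infinite a \<longleftrightarrow> (\<exists>i<length a. \<exists>j<length a. i \<noteq> j \<and> \<not> fin_ord (a ! i) \<and> \<not> fin_ord (a ! j))"

text \<open>For nonincreasing \<open>a\<^sub>1, \<dots>, a\<^sub>n\<close> with \<open>a\<^sub>2 \<noteq> 0\<close> this is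
  \<open>a\<^sub>1 \<oplus> ((a\<^sub>2 \<oplus> \<dots> \<oplus> a\<^sub>n) - 1)\<close>, written symmetrically: subtracting 1 from the left changes only
  finite ordinals, so it is visible exactly when at most one \<open>a\<^sub>i\<close> is infinite.\<close>

definition width_exp :: "'k::wellorder multiset list \<Rightarrow> 'k multiset" where
  "width_exp a = (if \<not> two_nonzero a then {#} else if two_infinite a then sum_list a
     else sum_list a - {#zero_exp#})"

section \<open>Arithmetic of the width exponent\<close>

lemma zero_exp_le [simp]: "zero_exp \<le> x"
  unfolding zero_exp_def by (rule Least_le) simp

lemma fin_ord_le: "a \<le> b \<Longrightarrow> fin_ord b \<Longrightarrow> fin_ord a"
proof -
  assume ab: "a \<le> b" and b: "fin_ord b"
  have "x = zero_exp" if x: "x \<in># a" for x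
  proof (rule ccontr)
    assume "x \<noteq> zero_exp"
    then have "zero_exp < x" by (metis zero_exp_le order.not_eq_order_implies_strict)
    then have "b < a"
      using x b by (intro ex_gt_imp_less_multiset) (auto simp: fin_ord_def)
    then show False using ab by simp
  qed
  then show "fin_ord a" by (auto simp: fin_ord_def)
qed

lemma fin_ord_less_infinite: "fin_ord a \<Longrightarrow> \<not> fin_ord b \<Longrightarrow> a < b"
  using fin_ord_le[of b a] by (cases "a < b") auto

lemma sum_list_update_mset:
  "i < length a \<Longrightarrow> sum_list (a[i := c]) + a ! i = sum_list a + (c::'k multiset)"
proof (induction a arbitrary: i)
  case (Cons x a)
  then show ?case by (cases i) (auto simp: ac_simps)
qed simp

lemma sum_list_update_less:
  fixes c :: "'k::wellorder multiset"
  assumes "i < length a" "c < a ! i"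
  shows "sum_list (a[i := c]) < sum_list a"
proof -
  have "sum_list (a[i := c]) + a ! i < sum_list a + a ! i"
    using sum_list_update_mset[OF assms(1), of c] assms(2) by simp
  then show ?thesis by simp
qed

lemma mem_sum_list_mset: "x \<in># sum_list a \<longleftrightarrow> (\<exists>i<length a. x \<in># a ! i)"
proof (induction a)
  case (Cons y a)
  then show ?case by (auto simp: less_Suc_eq_0_disj)
qed simp

lemma two_nonzeroI:
  "i < length a \<Longrightarrow> j < length a \<Longrightarrow> i \<noteq> j \<Longrightarrow> a ! i \<noteq> {#} \<Longrightarrow> a ! j \<noteq> {#} \<Longrightarrow> two_nonzero a"
  unfolding two_nonzero_def by blast

lemma two_infiniteI:
  "i < length a \<Longrightarrow> j < length a \<Longrightarrow> i \<noteq> j \<Longrightarrow> \<not> fin_ord (a ! i) \<Longrightarrow> \<not> fin_ord (a ! j) \<Longrightarrow> two_infinite a"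
  unfolding two_infinite_def by blast

lemma not_fin_ord_nonempty: "\<not> fin_ord x \<Longrightarrow> x \<noteq> {#}"
  by (auto simp: fin_ord_def)

text \<open>One of two nonzero coordinates is finite and contributes the exponent 0, so the
  difference in \<open>width_exp\<close> really removes an element.\<close>

lemma zero_exp_mem_sum_list:
  assumes "two_nonzero a" "\<not> two_infinite a"
  shows "zero_exp \<in># sum_list a"
proof -
  obtain i where i: "i < length a" "a ! i \<noteq> {#}" "fin_ord (a ! i)"
    using assms unfolding two_nonzero_def two_infinite_def by blast
  then have "zero_exp \<in># a ! i"
    unfolding fin_ord_def by (metis multiset_nonemptyE singletonD subsetD)
  then show ?thesis using i(1) unfolding mem_sum_list_mset by blast
qed

lemma sum_list_le_width_exp: "two_nonzero a \<Longrightarrow> sum_list a \<le> width_exp a + {#zero_exp#}"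
proof (cases "two_infinite a")
  case True
  assume "two_nonzero a"
  then have "width_exp a = sum_list a" using True by (simp add: width_exp_def)
  then show ?thesis by (metis less_eq_multiset_plus_right)
next
  case False
  assume "two_nonzero a"
  then have "width_exp a + {#zero_exp#} = sum_list a"
    using False zero_exp_mem_sum_list[of a] by (simp add: width_exp_def)
  then show ?thesis by (metis order_refl)
qed

text \<open>Two nonzero coordinates contribute at least two exponents, so something is left after
  removing one.\<close>

lemma width_exp_nonempty:
  assumes "two_nonzero a"
  shows "width_exp a \<noteq> {#}"
proof -
  obtain i j where ij: "i < length a" "j < length a" "i \<noteq> j" "a ! i \<noteq> {#}" "a ! j \<noteq> {#}"
    using assms unfolding two_nonzero_def by blast
  have "sum_list (a[i := {#}]) + a ! i = sum_list a"
    using sum_list_update_mset[OF ij(1), of "{#}"] by simp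
  moreover have "sum_list (a[i := {#}]) \<noteq> {#}"
  proof -
    obtain y where "y \<in># a ! j" using ij(5) by blast
    then have "y \<in># sum_list (a[i := {#}])" unfolding mem_sum_list_mset using ij by (intro exI[of _ j]) auto
    then show ?thesis by (metis empty_iff set_mset_empty)
  qed
  ultimately have "2 \<le> size (sum_list a)"
    using ij(4) by (metis One_nat_def Suc_leI add_mono nonempty_has_size one_add_one size_union)
  then have "sum_list a \<noteq> {#}" "\<not> sum_list a \<subseteq># {#zero_exp#}"
    using size_mset_mono[of "sum_list a" "{#zero_exp#}"] by (fastforce simp del: sum_list_eq_0_iff)+
  then have "sum_list a - {#zero_exp#} \<noteq> {#}" "sum_list a \<noteq> {#}"
    using Diff_eq_empty_iff_mset by blast+
  then show ?thesis using assms by (auto simp: width_exp_def)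
qed

text \<open>Lowering a coordinate cannot create an infinite one. Hence a subtraction of 1 present
  for \<open>a\<close> is still present afterwards, and one that newly appears only helps;
  strictness comes from the sum.\<close>

lemma width_exp_update_less:
  assumes "two_nonzero a" "i < length a" "c < a ! i"
  shows "width_exp (a[i := c]) < width_exp a"
proof (cases "two_nonzero (a[i := c])")
  case False
  then show ?thesis using width_exp_nonempty[OF assms(1)] by (simp add: width_exp_def)
next
  case nz: True
  let ?b = "a[i := c]"
  have less: "sum_list ?b < sum_list a" by (rule sum_list_update_less[OF assms(2,3)])
  have inf: "two_infinite a" if b: "two_infinite ?b"
  proof -
    obtain k l where kl: "k < length a" "l < length a" "k \<noteq> l" "\<not> fin_ord (?b ! k)" "\<not> fin_ord (?b ! l)"
      using b unfolding two_infinite_def length_list_update by blast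
    have "\<not> fin_ord (a ! m)" if "m < length a" "\<not> fin_ord (?b ! m)" for m
      using that fin_ord_le[OF less_imp_le[OF assms(3)]] by (cases "m = i") auto
    then show ?thesis using kl by (blast intro: two_infiniteI)
  qed
  show ?thesis
  proof (cases "two_infinite a")
    case True
    have "width_exp ?b \<le> sum_list ?b"
      by (auto simp: width_exp_def subset_eq_imp_le_multiset)
    then show ?thesis using True assms(1) less by (auto simp: width_exp_def)
  next
    case False
    then have nb: "\<not> two_infinite ?b" using inf by blast
    have "width_exp ?b + {#zero_exp#} < width_exp a + {#zero_exp#}"
      using zero_exp_mem_sum_list[OF nz nb] zero_exp_mem_sum_list[OF assms(1) False] False nb nz assms(1) less
      by (simp add: width_exp_def)
    then show ?thesis by simp
  qed
qed

text \<open>In the Dershowitz-Manna form of \<open>e < sum_list a\<close>, let \<open>x\<close> be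
  the largest exponent removed. Trading a single copy of \<open>x\<close> in one summand for all of
  \<open>Y\<close> removes no more than \<open>X\<close> does, so the new sum is still at least
  \<open>e\<close>.\<close>

lemma less_sum_listE:
  fixes e :: "'k::wellorder multiset"
  assumes "e < sum_list a"
  obtains i c where "i < length a" "c < a ! i" "e \<le> sum_list (a[i := c])"
proof -
  obtain X Y where X: "X \<noteq> {#}" "X \<subseteq># sum_list a" "e = sum_list a - X + Y"
    and Y: "\<And>k. k \<in># Y \<Longrightarrow> \<exists>x. x \<in># X \<and> k < x"
    using assms unfolding less_multiset\<^sub>D\<^sub>M by blast
  define x where "x = Max_mset X"
  have x: "x \<in># X" using X(1) by (simp add: x_def)
  have Yx: "Y < {#x#}"
    using Y by (auto simp: x_def) (metis Max_ge finite_set_mset order.strict_trans2)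
  obtain i where i: "i < length a" "x \<in># a ! i"
    using mset_subset_eqD[OF X(2) x] unfolding mem_sum_list_mset by blast
  define c where "c = a ! i - {#x#} + Y"
  have "c < a ! i - {#x#} + {#x#}" unfolding c_def by (rule add_strict_left_mono[OF Yx])
  then have c: "c < a ! i" using i(2) by simp
  have "sum_list (a[i := c]) + a ! i = sum_list a - {#x#} + Y + a ! i"
  proof -
    have "sum_list (a[i := c]) + a ! i = sum_list a + (a ! i - {#x#} + Y)"
      using sum_list_update_mset[OF i(1)] by (simp add: c_def)
    also have "\<dots> = (sum_list a - {#x#} + {#x#}) + (a ! i - {#x#} + Y)"
      using mset_subset_eqD[OF X(2) x] by simp
    also have "\<dots> = sum_list a - {#x#} + Y + (a ! i - {#x#} + {#x#})" by (simp only: ac_simps)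
    finally show ?thesis using i(2) by simp
  qed
  then have s: "sum_list (a[i := c]) = sum_list a - {#x#} + Y" by simp
  have "sum_list a - X \<subseteq># sum_list a - {#x#}"
    using x by (auto simp: subseteq_mset_def count_greater_zero_iff[symmetric] simp del: count_greater_zero_iff)
  then have "e \<le> sum_list (a[i := c])" unfolding X(3) s by (intro subset_eq_imp_le_multiset) simp
  then show ?thesis using that i c by blast
qed

text \<open>The counterpart of \<open>width_exp_update_less\<close> that drives the lower bound:
  lowering one coordinate reaches every \<open>e\<close> below. \<open>less_sum_listE\<close> finds
  the coordinate; the work lies where lowering it changes the case of
  \<open>width_exp\<close>.\<close>

lemma less_width_expE:
  assumes nz: "two_nonzero a" and e: "e < width_exp a"
  obtains i c where "i < length a" "c < a ! i" "e \<le> width_exp (a[i := c])"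
proof (cases "two_infinite a")
  case True
  then have "e < sum_list a" using nz e by (simp add: width_exp_def)
  then obtain i c where ic: "i < length a" "c < a ! i" "e \<le> sum_list (a[i := c])"
    by (rule less_sum_listE)
  show ?thesis
  proof (cases "two_infinite (a[i := c])")
    case True
    have "two_nonzero (a[i := c])"
      using True unfolding two_infinite_def by (metis two_nonzeroI not_fin_ord_nonempty)
    then show ?thesis using ic True that by (simp add: width_exp_def)
  next
    case False
    obtain k l where kl: "k < length a" "l < length a" "k \<noteq> l" "\<not> fin_ord (a ! k)" "\<not> fin_ord (a ! l)"
      using \<open>two_infinite a\<close> unfolding two_infinite_def by blast
    obtain j where j: "j < length a" "j \<noteq> i" "\<not> fin_ord (a ! j)" using kl by metis
    have infi: "\<not> fin_ord (a ! i)"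
    proof
      assume "fin_ord (a ! i)"
      then have "i \<noteq> k" "i \<noteq> l" using kl by auto
      then have "two_infinite (a[i := c])" using kl by (intro two_infiniteI[of k _ l]) auto
      then show False using False by blast
    qed
    have "fin_ord c"
    proof (rule ccontr)
      assume "\<not> fin_ord c"
      then have "two_infinite (a[i := c])"
        using ic(1) j by (intro two_infiniteI[of i _ j]) auto
      then show False using False by blast
    qed
    then have "fin_ord (c + {#zero_exp#})" by (simp add: fin_ord_def)
    \<comment> \<open>The second infinite coordinate was lost, which costs a 1. As
      \<open>a ! i\<close> is infinite and \<open>c\<close> finite, \<open>c\<close> can be raised
      by one to pay for it.\<close>
    then have c': "c + {#zero_exp#} < a ! i" using infi by (rule fin_ord_less_infinite)
    let ?b = "a[i := c + {#zero_exp#}]"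
    have "two_nonzero ?b"
      using ic(1) j not_fin_ord_nonempty by (intro two_nonzeroI[of i _ j]) auto
    then have "sum_list ?b \<le> width_exp ?b + {#zero_exp#}" by (rule sum_list_le_width_exp)
    moreover have "sum_list ?b = sum_list (a[i := c]) + {#zero_exp#}"
    proof -
      have "sum_list ?b + a ! i = (sum_list (a[i := c]) + {#zero_exp#}) + a ! i"
        using sum_list_update_mset[OF ic(1), of c] sum_list_update_mset[OF ic(1), of "c + {#zero_exp#}"]
        by (simp add: ac_simps)
      then show ?thesis by simp
    qed
    ultimately have "sum_list (a[i := c]) \<le> width_exp ?b" by simp
    then show ?thesis using that[OF ic(1) c'] ic(3) by simp
  qed
next
  case False
  \<comment> \<open>Adding 1 undoes the subtraction in \<open>width_exp a\<close>, so the statement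
    about sums applies to \<open>e + 1\<close>.\<close>
  have "e + {#zero_exp#} < sum_list a"
  proof -
    have "e + {#zero_exp#} < width_exp a + {#zero_exp#}" using e by simp
    also have "\<dots> = sum_list a"
      using zero_exp_mem_sum_list[OF nz False] False nz by (simp add: width_exp_def)
    finally show ?thesis .
  qed
  then obtain i c where ic: "i < length a" "c < a ! i" "e + {#zero_exp#} \<le> sum_list (a[i := c])"
    by (rule less_sum_listE)
  show ?thesis
  proof (cases "two_nonzero (a[i := c])")
    case True
    have "e + {#zero_exp#} \<le> width_exp (a[i := c]) + {#zero_exp#}"
      using ic(3) sum_list_le_width_exp[OF True] by (rule order_trans)
    then show ?thesis using that ic by simp
  next
    case nz': False
    obtain k l where kl: "k < length a" "l < length a" "k \<noteq> l" "a ! k \<noteq> {#}" "a ! l \<noteq> {#}"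
      using nz unfolding two_nonzero_def by blast
    obtain j where j: "j < length a" "j \<noteq> i" "a ! j \<noteq> {#}" using kl by metis
    \<comment> \<open>Only one nonzero coordinate remains after the update, so \<open>c\<close>
      vanishes and \<open>a\<close> is zero outside \<open>i\<close> and \<open>j\<close>.\<close>
    have c0: "c = {#}"
    proof (rule ccontr)
      assume "c \<noteq> {#}"
      then have "two_nonzero (a[i := c])" 
        using ic(1) j by (intro two_nonzeroI[of i _ j]) auto
      then show False using nz' by blast
    qed
    have other: "a ! m = {#}" if "m < length a" "m \<noteq> i" "m \<noteq> j" for m
    proof (rule ccontr)
      assume "a ! m \<noteq> {#}"
      then have "two_nonzero (a[i := c])" 
        using that j by (intro two_nonzeroI[of m _ j]) auto
      then show False using nz' by blast
    qed
    have sum_j: "sum_list (a[i := c]) = a ! j"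
    proof -
      have "sum_list (a[i := c, j := {#}]) = {#}"
      proof (rule ccontr)
        assume "sum_list (a[i := c, j := {#}]) \<noteq> {#}"
        then obtain x where "x \<in># sum_list (a[i := c, j := {#}])" by blast
        then obtain m where "m < length a" "x \<in># a[i := c, j := {#}] ! m"
          unfolding mem_sum_list_mset by auto
        then show False using other[of m] c0 ic(1) j by (auto simp: nth_list_update split: if_splits)
      qed
      then show ?thesis using sum_list_update_mset[of j "a[i := c]" "{#}"] j by simp
    qed
    have ai: "a ! i \<noteq> {#}" using ic(2) by auto
    show ?thesis
    proof (cases "e = {#}")
      case True
      then show ?thesis using that[OF ic(1,2)] by simp
    next
      case e0: False
      have "e < e + {#zero_exp#}" by simp
      also have "\<dots> \<le> a ! j" using ic(3) sum_j by simp
      finally have ej: "e < a ! j" .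
      \<comment> \<open>Lower coordinate \<open>j\<close> to \<open>e\<close> instead. The sum
        becomes \<open>a ! i + e\<close>, and \<open>a ! i\<close> is at least 1, which covers the
        possible subtraction. Having \<open>e\<close> nonzero keeps two nonzero coordinates.\<close>
      let ?b = "a[j := e]"
      have nzb: "two_nonzero ?b" 
        using ic(1) j ai e0 by (intro two_nonzeroI[of i _ j]) auto
      have "sum_list ?b = a ! i + e"
      proof -
        have "sum_list a = a ! j + a ! i"
          using sum_list_update_mset[OF ic(1), of c] sum_j c0 by simp
        then have "sum_list ?b + a ! j = (a ! i + e) + a ! j"
          using sum_list_update_mset[OF j(1), of e] by (simp add: ac_simps)
        then show ?thesis by simp
      qed
      moreover have "{#zero_exp#} \<le> a ! i"
      proof (rule ccontr)
        assume "\<not> {#zero_exp#} \<le> a ! i"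
        then have "\<forall>x\<in>#a ! i. x < zero_exp" by (simp add: not_le)
        then show False using ai by (metis multiset_nonemptyE not_le zero_exp_le)
      qed
      ultimately have "e + {#zero_exp#} \<le> width_exp ?b + {#zero_exp#}"
        using sum_list_le_width_exp[OF nzb] by (metis add.commute add_left_mono order_trans)
      then show ?thesis using that[OF j(1) ej] by simp
    qed
  qed
qed

section \<open>Width of a product of powers of omega\<close>

lemma box_eq_cell: "box a = cell (replicate (length a) {#}) a"
  by (auto simp: box_def cell_def)

lemma less_single_empty_iff: "z < {#{#}#} \<longleftrightarrow> z = {#}" for z :: "'k::wellorder multiset multiset"
  by (cases z) auto

text \<open>A zero exponent leaves a single value in its coordinate, so at most one coordinate
  varies, and there the order is linear.\<close>

lemma cell_residual_chain:
  assumes "\<not> two_nonzero b" "x \<in> cell p b" "y \<in> cell p b"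
  shows "\<not> incomparable (list_all2 (\<le>)) x y"
proof -
  have len: "length x = length b" "length y = length b" using assms by (auto simp: cell_def)
  have eq: "x ! i = y ! i" if i: "i < length b" "b ! i = {#}" for i
  proof -
    obtain z z' where "z < {#b ! i#}" "x ! i = p ! i + z" "z' < {#b ! i#}" "y ! i = p ! i + z'"
      using assms(2,3) i(1) unfolding cell_def by blast
    then show ?thesis using i(2) by (simp add: less_single_empty_iff del: mset_lt_single_right_iff)
  qed
  show ?thesis
  proof (cases "\<exists>i<length b. b ! i \<noteq> {#}")
    case False
    then have "x = y" using eq len by (auto intro!: nth_equalityI)
    then show ?thesis by (simp add: incomparable_def list.rel_refl)
  next
    case True
    then obtain i where i: "i < length b" "b ! i \<noteq> {#}" by blast
    have eq': "x ! j = y ! j" if "j < length b" "j \<noteq> i" for j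
      using eq[OF that(1)] two_nonzeroI[of i b j] i that assms(1) by blast
    have "x ! j \<le> y ! j" if "x ! i \<le> y ! i" "j < length b" for j
      using that eq'[of j] by (cases "j = i") auto
    moreover have "y ! j \<le> x ! j" if "y ! i \<le> x ! i" "j < length b" for j
      using that eq'[of j] by (cases "j = i") auto
    ultimately show ?thesis
      using len linear[of "x ! i" "y ! i"] unfolding incomparable_def list_all2_conv_all_nth by auto
  qed
qed

lemma finite_subsets_mset: "finite {q. q \<subseteq># (N :: 'a multiset)}"
proof (induction N)
  case (add x N)
  have "{q. q \<subseteq># add_mset x N} \<subseteq> {q. q \<subseteq># N} \<union> add_mset x ` {q. q \<subseteq># N}"
  proof
    fix q assume q: "q \<in> {q. q \<subseteq># add_mset x N}"
    show "q \<in> {q. q \<subseteq># N} \<union> add_mset x ` {q. q \<subseteq># N}"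
    proof (cases "x \<in># q")
      case True
      then obtain q' where "q = add_mset x q'" by (metis insert_DiffM)
      then show ?thesis using q by auto
    next
      case False
      have "count q y \<le> count N y" for y
        using q False by (cases "y = x") (auto simp: subseteq_mset_def not_in_iff dest: spec[of _ y])
      then have "q \<subseteq># N" by (rule mset_subset_eqI)
      then show ?thesis by blast
    qed
  qed
  then show ?case by (rule finite_subset) (use add in auto)
qed simp

text \<open>Anything incomparable to \<open>x\<close> is strictly below \<open>x\<close> in some
  coordinate \<open>i\<close>, and \<open>less_multiset_prefixE\<close> puts that coordinate into a
  translate of length \<omega>^c for an exponent \<open>c\<close> occurring in \<open>x\<close>
  relative to \<open>p\<close>; such a \<open>c\<close> is below \<open>b ! i\<close>.\<close>

lemma cell_residual_cover:
  assumes x: "x \<in> cell p b"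
  shows "\<exists>D. finite D \<and> residual (list_all2 (\<le>)) (cell p b) [x] \<subseteq> (\<Union>d\<in>D. cell (fst d) (snd d)) \<and>
    (\<forall>d\<in>D. width_exp (snd d) < width_exp b)"
proof (cases "two_nonzero b")
  case False
  then have "residual (list_all2 (\<le>)) (cell p b) [x] = {}"
    using cell_residual_chain[OF False x] by (auto simp: residual_def)
  then show ?thesis by (intro exI[of _ "{}"]) simp
next
  case True
  let ?n = "length b"
  have len: "length x = ?n" "length p = ?n" using x by (auto simp: cell_def)
  obtain z where z: "\<And>i. i < ?n \<Longrightarrow> z i < {#b ! i#}" "\<And>i. i < ?n \<Longrightarrow> x ! i = p ! i + z i"
    using x unfolding cell_def by (auto simp: Bex_def) metis
  \<comment> \<open>One cell for each coordinate \<open>i\<close>, exponent \<open>c\<close> and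
    leading part \<open>q\<close>; only coordinate \<open>i\<close> changes.\<close>
  define D where "D = (\<Union>i<?n. \<Union>c\<in>set_mset (z i). \<Union>q\<in>{q. q \<subseteq># z i}.
    {(p[i := p ! i + q], b[i := c])})"
  have "finite D" unfolding D_def by (intro finite_UN_I finite_subsets_mset) auto
  moreover have "width_exp (snd d) < width_exp b" if d: "d \<in> D" for d
  proof -
    obtain i c where "i < ?n" "c \<in># z i" "snd d = b[i := c]" using d unfolding D_def by auto
    moreover have "c < b ! i" using z(1) calculation by auto
    ultimately show ?thesis using width_exp_update_less[OF True] by simp
  qed
  moreover have "residual (list_all2 (\<le>)) (cell p b) [x] \<subseteq> (\<Union>d\<in>D. cell (fst d) (snd d))"
  proof
    fix y assume "y \<in> residual (list_all2 (\<le>)) (cell p b) [x]"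
    then have y: "y \<in> cell p b" "\<not> list_all2 (\<le>) x y" by (auto simp: residual_def incomparable_def)
    have leny: "length y = ?n" using y by (auto simp: cell_def)
    obtain i where i: "i < ?n" "y ! i < x ! i"
      using y(2) len leny by (auto simp: list_all2_conv_all_nth not_le)
    obtain z' where z': "\<And>j. j < ?n \<Longrightarrow> z' j < {#b ! j#}" "\<And>j. j < ?n \<Longrightarrow> y ! j = p ! j + z' j"
      using y(1) unfolding cell_def by (auto simp: Bex_def) metis
    \<comment> \<open>The common offset \<open>p ! i\<close> cancels.\<close>
    have "z' i < z i" using i z(2) z'(2) by simp
    then obtain c q w where c: "c \<in># z i" "q \<subseteq># z i" "z' i = q + w" "w < {#c#}"
      by (rule less_multiset_prefixE)
    have "\<exists>v<{#b[i := c] ! j#}. y ! j = p[i := p ! i + q] ! j + v" if "j < ?n" for j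
    proof (cases "j = i")
      case True
      then show ?thesis using c(3,4) z'(2)[OF i(1)] i(1) len by (intro exI[of _ w]) (auto simp: ac_simps)
    next
      case False
      then show ?thesis using z'[OF that] by (intro exI[of _ "z' j"]) auto
    qed
    then have "y \<in> cell (p[i := p ! i + q]) (b[i := c])"
      unfolding cell_def using len leny by simp
    moreover have "(p[i := p ! i + q], b[i := c]) \<in> D" unfolding D_def using i(1) c by blast
    ultimately show "y \<in> (\<Union>d\<in>D. cell (fst d) (snd d))" by force
  qed
  ultimately show ?thesis by blast
qed

text \<open>\<open>C\<close> lists the cells still available. A move inside one of them replaces it
  by finitely many cells of smaller exponent, which is a descent in the multiset order, so the
  multiset of exponents is itself the ordinal bound.\<close>

lemma width_le_cells:
  fixes C :: "('k::wellorder multiset multiset list \<times> 'k multiset list) multiset"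
  assumes "A \<subseteq> (\<Union>d\<in>set_mset C. cell (fst d) (snd d))"
  shows "width_le (list_all2 (\<le>)) A (image_mset (\<lambda>d. width_exp (snd d)) C)"
  using assms
proof (induction "image_mset (\<lambda>d. width_exp (snd d)) C" arbitrary: A C rule: less_induct)
  case less
  let ?le = "list_all2 (\<le>) :: 'k multiset multiset list \<Rightarrow> _"
  let ?m = "image_mset (\<lambda>d. width_exp (snd d)) :: ('k multiset multiset list \<times> 'k multiset list) multiset \<Rightarrow> _"
  show ?case
  proof (rule width_leI)
    fix x assume x: "x \<in> A"
    then obtain d where d: "d \<in># C" "x \<in> cell (fst d) (snd d)" using less.prems by blast
    obtain D where D: "finite D" "residual ?le (cell (fst d) (snd d)) [x] \<subseteq> (\<Union>d\<in>D. cell (fst d) (snd d))"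
      "\<And>d'. d' \<in> D \<Longrightarrow> width_exp (snd d') < width_exp (snd d)"
      using cell_residual_cover[OF d(2)] by blast
    define C' where "C' = (C - {#d#}) + mset_set D"
    have C: "C = (C - {#d#}) + {#d#}" using d(1) by simp
    have "?m (mset_set D) < {#width_exp (snd d)#}" using D(1,3) by simp
    then have "?m (C - {#d#}) + ?m (mset_set D) < ?m (C - {#d#}) + ?m {#d#}"
      by (intro add_strict_left_mono) simp
    then have less': "?m C' < ?m C" using C by (metis C'_def image_mset_union)
    have "residual ?le A [x] \<subseteq> (\<Union>d\<in>set_mset C'. cell (fst d) (snd d))"
    proof
      fix y assume y: "y \<in> residual ?le A [x]"
      then have "y \<in> A" by (simp add: residual_def)
      then obtain e where e: "e \<in># C" "y \<in> cell (fst e) (snd e)" using less.prems by blast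
      \<comment> \<open>A point lying in another cell stays covered by that cell; only the cell
        containing the move is refined.\<close>
      show "y \<in> (\<Union>d\<in>set_mset C'. cell (fst d) (snd d))"
      proof (cases "e = d")
        case True
        then have "y \<in> residual ?le (cell (fst d) (snd d)) [x]" using y e by (simp add: residual_def)
        then show ?thesis using D(1,2) by (auto simp: C'_def)
      next
        case False
        then have "e \<in># C'" using e(1) by (simp add: C'_def in_diff_count)
        then show ?thesis using e(2) by blast
      qed
    qed
    then have "width_le ?le (residual ?le A [x]) (?m C')" using less.hyps[OF less'] by blast
    then show "\<exists>\<xi><?m C. width_le ?le (residual ?le A [x]) \<xi>" using less' by blast
  qed
qed

lemma width_le_box:
  fixes a :: "'k::wellorder multiset list"
  shows "width_le (list_all2 (\<le>)) (box a) {#width_exp a#}"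
  using width_le_cells[of "box a" "{#(replicate (length a) {#}, a)#}"] by (simp add: box_eq_cell)

section \<open>Lower bound: stacking slabs\<close>

lemma le_replicate_mset_subset:
  fixes \<xi> :: "'o::linorder multiset"
  assumes "replicate_mset n c \<le> \<xi>" "\<And>x. x \<in># \<xi> \<Longrightarrow> x \<le> c"
  shows "replicate_mset n c \<subseteq># \<xi>"
proof (rule ccontr)
  assume "\<not> ?thesis"
  \<comment> \<open>With fewer than \<open>n\<close> copies of the largest admissible exponent,
    \<open>\<xi>\<close> would be below \<omega>^c n.\<close>
  then have "count \<xi> c < n" by (auto simp: subseteq_mset_def not_le split: if_splits)
  then have "\<xi> < replicate_mset n c"
    using assms(2) by (intro ex_gt_count_imp_le_multiset[of _ _ c]) (auto split: if_splits)
  then show False using assms(1) by simp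
qed

text \<open>Play in \<open>A\<close> first: whatever finite \<open>F\<close> was played there, the set \<open>B\<close> still contributes its full
  width afterwards.\<close>

lemma width_ge_add:
  fixes e :: "'o::wellorder"
  assumes "width_ge le A \<xi>" "A \<subseteq> C" "\<xi> \<le> {#e#}"
    "\<And>F. finite F \<Longrightarrow> F \<subseteq> A \<Longrightarrow>
       \<exists>B\<subseteq>C. (\<forall>x\<in>F. \<forall>y\<in>B. incomparable le x y) \<and> width_ge le B (replicate_mset n e)"
  shows "width_ge le C (replicate_mset n e + \<xi>)"
  using assms
proof (induction \<xi> arbitrary: A C rule: less_induct)
  case (less \<xi>)
  let ?\<zeta> = "replicate_mset n e"
  have C\<zeta>: "width_ge le C ?\<zeta>"
    using less.prems(4)[of "{}"] by (auto intro: width_ge_subset)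
  show ?case
  proof (rule width_geI)
    fix \<eta> assume \<eta>: "\<eta> < ?\<zeta> + \<xi>"
    show "\<exists>x\<in>C. width_ge le (residual le C [x]) \<eta>"
    proof (cases "\<eta> < ?\<zeta>")
      case True
      \<comment> \<open>Below \<omega>^e n, the set \<open>B\<close> obtained for
        \<open>F = {}\<close> already suffices.\<close>
      then show ?thesis using width_geD[OF C\<zeta>] by blast
    next
      case False
      have "\<eta> < replicate_mset n e + {#e#}"
        using \<eta> less.prems(3) by (meson add_left_mono order.strict_trans2)
      then have "\<eta> < {#e#} + replicate_mset n e" by (simp only: add.commute)
      moreover have "x \<le> e" if x: "x \<in># \<eta>" for x
      proof (rule ccontr)
        assume "\<not> x \<le> e"
        then have "replicate_mset n e + {#e#} < \<eta>"
          using x by (intro ex_gt_imp_less_multiset exI[of _ x]) (auto split: if_splits)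
        then show False using calculation by (metis add.commute less_asym)
      qed
      \<comment> \<open>Now \<open>\<eta>\<close> lies between \<omega>^e n and \<omega>^e (n + 1),
        so it begins with \<open>n\<close> copies of \<omega>^e; the remainder is below
        \<open>\<xi>\<close> and is played in \<open>A\<close>.\<close>
      ultimately have "?\<zeta> \<subseteq># \<eta>" using False by (intro le_replicate_mset_subset) auto
      then obtain \<eta>' where \<eta>': "\<eta> = ?\<zeta> + \<eta>'" by (metis subset_mset.add_diff_inverse)
      then have less': "\<eta>' < \<xi>" using \<eta> by simp
      then obtain x where x: "x \<in> A" "width_ge le (residual le A [x]) \<eta>'"
        using width_geD[OF less.prems(1)] by blast
      have "width_ge le (residual le C [x]) (?\<zeta> + \<eta>')"
      proof (rule less.IH[OF less' x(2)])
        show "residual le A [x] \<subseteq> residual le C [x]" by (rule residual_mono[OF less.prems(2)])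
        show "\<eta>' \<le> {#e#}" using less' less.prems(3) by (meson less_imp_le order_trans)
        fix F assume F: "finite F" "F \<subseteq> residual le A [x]"
        \<comment> \<open>The element just played joins the finite set that \<open>B\<close> has to
          avoid.\<close>
        then have "finite (insert x F)" "insert x F \<subseteq> A" using x(1) by (auto simp: residual_def)
        then obtain B where B: "B \<subseteq> C" "\<forall>w\<in>insert x F. \<forall>y\<in>B. incomparable le w y" "width_ge le B ?\<zeta>"
          using less.prems(4) by meson
        then have "B \<subseteq> residual le C [x]" by (auto simp: residual_def)
        then show "\<exists>B\<subseteq>residual le C [x]. (\<forall>x\<in>F. \<forall>y\<in>B. incomparable le x y) \<and> width_ge le B ?\<zeta>"
          using B by blast
      qed
      then show ?thesis using x(1) less.prems(2) \<eta>' by blast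
    qed
  qed
qed

text \<open>\<open>k\<close> counts the blocks of length \<omega>^c still to be played in coordinate
  \<open>i\<close>; \<open>q\<close> is the threshold in coordinate \<open>j\<close> imposed by the
  moves already made.\<close>

definition slab :: "'o::wellorder list \<Rightarrow> nat \<Rightarrow> 'o \<Rightarrow> nat \<Rightarrow> nat \<Rightarrow> 'o multiset \<Rightarrow> 'o multiset list set" where
  "slab a i c k j q = {y \<in> box a. y ! i < replicate_mset k c \<and> q \<le> y ! j}"

text \<open>Induction on the number of blocks. The top block contains a copy of
  \<open>box (a[i := c])\<close> and is played first; then the threshold in coordinate
  \<open>j\<close> rises above everything played, so elements of lower blocks are smaller in
  \<open>i\<close> and larger in \<open>j\<close>, hence incomparable. The exponent
  \<open>o'\<close> below \<open>a ! j\<close> leaves room for the rise.\<close>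

lemma width_ge_slab:
  fixes a :: "'o::wellorder list"
  assumes i: "i < length a" and j: "j < length a" "i \<noteq> j" and c: "c < a ! i" and o: "o' < a ! j"
    and ge: "width_ge (list_all2 (\<le>)) (box (a[i := c])) {#e#}"
  shows "q < {#a ! j#} \<Longrightarrow> width_ge (list_all2 (\<le>)) (slab a i c k j q) (replicate_mset k e)"
proof (induction k arbitrary: q)
  case 0
  show ?case by (rule width_geI) simp
next
  case (Suc k)
  let ?le = "list_all2 (\<le>) :: 'o multiset list \<Rightarrow> _"
  \<comment> \<open>The shift moves the smaller box into the top block of coordinate
    \<open>i\<close> and above \<open>q\<close> in coordinate \<open>j\<close>. Adding a fixed
    multiset preserves and reflects the order.\<close>
  let ?h = "\<lambda>y. y[i := replicate_mset k c + y ! i, j := q + y ! j]"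
  define A where "A = ?h ` box (a[i := c])"
  have lenb: "length y = length a" if "y \<in> box (a[i := c])" for y using that by (simp add: box_def)
  have yi: "y ! i < {#c#}" if "y \<in> box (a[i := c])" for y
    using that i unfolding box_def by (auto simp del: mset_lt_single_right_iff)
  have ym: "y ! m < {#a ! m#}" if "y \<in> box (a[i := c])" "m < length a" "m \<noteq> i" for y m
    using that unfolding box_def by (auto simp del: mset_lt_single_right_iff)
  have sub: "A \<subseteq> slab a i c (Suc k) j q"
  proof
    fix w assume "w \<in> A"
    then obtain y where y: "y \<in> box (a[i := c])" "w = ?h y" by (auto simp: A_def)
    have wi: "w ! i = replicate_mset k c + y ! i" and wj: "w ! j = q + y ! j"
      using y lenb[OF y(1)] i j by auto
    have "w ! m < {#a ! m#}" if m: "m < length a" for m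
    proof -
      consider "m = i" | "m = j" | "m \<noteq> i" "m \<noteq> j" by blast
      then show ?thesis
      proof cases
        case 1
        have "\<forall>x\<in>#y ! i. x < a ! i" using yi[OF y(1)] c by auto
        then show ?thesis using 1 wi c by (auto split: if_splits)
      next
        case 2
        then show ?thesis using wj ym[OF y(1) j(1)] j(2) Suc.prems by auto
      next
        case 3
        then show ?thesis using ym[OF y(1) m] y(2) by simp
      qed
    qed
    moreover have "w ! i < replicate_mset (Suc k) c"
    proof -
      have "replicate_mset k c + y ! i < replicate_mset k c + {#c#}"
        by (rule add_strict_left_mono[OF yi[OF y(1)]])
      then show ?thesis using wi by simp
    qed
    ultimately show "w \<in> slab a i c (Suc k) j q"
      using y lenb[OF y(1)] wj by (auto simp: slab_def box_def)
  qed
  have "width_ge ?le A {#e#}"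
  proof (rule width_ge_image[OF ge, of ?h])
    fix y assume "y \<in> box (a[i := c])"
    then show "?h y \<in> A" by (auto simp: A_def)
  next
    fix x y assume xy: "x \<in> box (a[i := c])" "y \<in> box (a[i := c])" "incomparable ?le x y"
    have "?h x ! m \<le> ?h y ! m \<longleftrightarrow> x ! m \<le> y ! m"
      if "m < length a" "length x = length a" "length y = length a" for m x y
      using that i j by (auto simp: nth_list_update)
    then have "?le (?h x) (?h y) \<longleftrightarrow> ?le x y" if "length x = length a" "length y = length a" for x y
      using that by (simp add: list_all2_conv_all_nth)
    then show "incomparable ?le (?h x) (?h y)"
      using xy lenb by (simp add: incomparable_def)
  qed
  moreover note sub
  moreover have "\<exists>B\<subseteq>slab a i c (Suc k) j q. (\<forall>x\<in>F. \<forall>y\<in>B. incomparable ?le x y) \<and>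
      width_ge ?le B (replicate_mset k e)" if F: "finite F" "F \<subseteq> A" for F
  proof -
    \<comment> \<open>This is at least \<open>q\<close> and strictly above each played
      \<open>x ! j\<close>, strictness coming from \<open>o'\<close>. It stays below
      \<omega>^(\<open>a ! j\<close>), which is closed under natural sums.\<close>
    define q' where "q' = add_mset o' (q + (\<Sum>x\<in>F. x ! j))"
    have box: "x \<in> box a" if "x \<in> F" for x using that F sub by (auto simp: slab_def)
    have "\<forall>y\<in>#x ! j. y < a ! j" if "x \<in> F" for x using box[OF that] j by (auto simp: box_def)
    then have "q' < {#a ! j#}" using o Suc.prems F by (auto simp: q'_def set_mset_sum)
    then have "width_ge ?le (slab a i c k j q') (replicate_mset k e)" by (rule Suc.IH)
    moreover have "slab a i c k j q' \<subseteq> slab a i c (Suc k) j q"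
    proof
      fix y assume "y \<in> slab a i c k j q'"
      then have y: "y \<in> box a" "y ! i < replicate_mset k c" "q' \<le> y ! j" by (auto simp: slab_def)
      have "q \<le> q'" by (intro subset_eq_imp_le_multiset) (simp add: q'_def subset_mset.le_iff_add[of q])
      moreover have "replicate_mset k c \<le> replicate_mset (Suc k) c"
        by (intro subset_eq_imp_le_multiset) simp
      ultimately show "y \<in> slab a i c (Suc k) j q" 
        unfolding slab_def mem_Collect_eq using y by (meson order.strict_trans2 order_trans)
    qed
    moreover have "incomparable ?le x y" if xF: "x \<in> F" and ys: "y \<in> slab a i c k j q'" for x y
    proof -
      obtain u where u: "u \<in> box (a[i := c])" "x = ?h u" using xF F by (auto simp: A_def)
      have xi: "x ! i = replicate_mset k c + u ! i" using u lenb[OF u(1)] i j by auto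
      have y: "y \<in> box a" "y ! i < replicate_mset k c" "q' \<le> y ! j" using ys by (auto simp: slab_def)
      have "replicate_mset k c \<le> x ! i" unfolding xi by simp
      then have "y ! i < x ! i" using y(2) by (rule order.strict_trans2[rotated])
      have "x ! j \<subseteq># (\<Sum>x\<in>F. x ! j)"
        using xF F(1) by (metis sum.remove mset_subset_eq_add_left)
      then have "x ! j \<subseteq># q + (\<Sum>x\<in>F. x ! j)" by (simp add: subset_mset.add_increasing)
      then have "x ! j \<subset># q'" unfolding q'_def
        by (metis mset_subset_add_mset subset_mset.le_less_trans multi_psub_of_add_self)
      then have "x ! j < y ! j" using y(3) subset_imp_less_mset by (metis order.strict_trans2)
      have len: "length x = length a" "length y = length a" using box[OF xF] y(1) by (auto simp: box_def)
      show ?thesis unfolding incomparable_def list_all2_conv_all_nth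
        using \<open>y ! i < x ! i\<close> \<open>x ! j < y ! j\<close> i j len by (auto simp: not_le)
    qed
    ultimately show ?thesis by blast
  qed
  ultimately have "width_ge ?le (slab a i c (Suc k) j q) (replicate_mset k e + {#e#})"
    by (intro width_ge_add[of _ A]) auto
  then show ?case by simp
qed

lemma width_ge_box:
  fixes a :: "'k::wellorder multiset list"
  shows "width_ge (list_all2 (\<le>)) (box a) {#width_exp a#}"
proof (induction "width_exp a" arbitrary: a rule: less_induct)
  case less
  let ?le = "list_all2 (\<le>) :: 'k multiset multiset list \<Rightarrow> _"
  show ?case
  proof (cases "two_nonzero a")
    case False
    show ?thesis
    proof (rule width_geI)
      fix \<xi> assume "\<xi> < {#width_exp a#}"
      \<comment> \<open>Here the claimed width is \<omega>^0 = 1, so a single move is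
        enough.\<close>
      then have "\<xi> = {#}" using False by (simp add: width_exp_def less_single_empty_iff del: mset_lt_single_right_iff)
      moreover have "replicate (length a) {#} \<in> box a" by (simp add: box_def)
      moreover have "width_ge ?le B {#}" for B by (rule width_geI) simp
      ultimately show "\<exists>x\<in>box a. width_ge ?le (residual ?le (box a) [x]) \<xi>" by blast
    qed
  next
    case True
    \<comment> \<open>As \<open>width_exp a\<close> is nonzero,
      \<omega>^(\<open>width_exp a\<close>) is the supremum of the \<omega>^e k with
      \<open>e < width_exp a\<close>.\<close>
    have *: "width_ge ?le (box a) (replicate_mset k e)" if e: "e < width_exp a" for k e
    proof -
      obtain i c where ic: "i < length a" "c < a ! i" "e \<le> width_exp (a[i := c])"
        by (rule less_width_expE[OF True e])
      obtain j where j: "j < length a" "j \<noteq> i" "a ! j \<noteq> {#}"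
        using True unfolding two_nonzero_def by metis
      have "width_ge ?le (box (a[i := c])) {#width_exp (a[i := c])#}"
        by (rule less.hyps[OF width_exp_update_less[OF True ic(1,2)]])
      then have "width_ge ?le (box (a[i := c])) {#e#}"
        by (rule width_ge_mono) (use ic(3) in \<open>simp only: mset_le_single_iff\<close>)
      then have "width_ge ?le (slab a i c k j {#}) (replicate_mset k e)"
        using j ic by (intro width_ge_slab[where o' = "{#}"]) auto
      then show ?thesis by (rule width_ge_subset) (auto simp: slab_def)
    qed
    show ?thesis
    proof (rule width_geI)
      fix \<xi> assume \<xi>: "\<xi> < {#width_exp a#}"
      \<comment> \<open>The leading exponent of \<open>\<xi>\<close>, or 0 if \<open>\<xi>\<close>
        is 0; one copy more than \<open>\<xi>\<close> has gives an \<omega>^e k above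
        \<open>\<xi>\<close>.\<close>
      define e where "e = (if \<xi> = {#} then {#} else Max_mset \<xi>)"
      define k where "k = Suc (count \<xi> e)"
      have "e < width_exp a" using \<xi> width_exp_nonempty[OF True] by (auto simp: e_def)
      moreover have "\<xi> < replicate_mset k e"
        by (rule ex_gt_count_imp_le_multiset[of _ _ e]) (auto simp: e_def k_def split: if_splits)
      ultimately show "\<exists>x\<in>box a. width_ge ?le (residual ?le (box a) [x]) \<xi>"
        using *[of e k] width_geD by blast
    qed
  qed
qed

section \<open>Order types of well-orders\<close>

text \<open>The bridge between ordinals given as relations on unrelated types and ordinals as points
  of one well-ordered type: \<open>a\<close> stands for its initial segment.\<close>

definition ord_type :: "'x rel \<Rightarrow> 'o::wellorder \<Rightarrow> bool" where
  "ord_type r a \<longleftrightarrow> (\<exists>h. bij_betw h (Field r) {..<a} \<and>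
     (\<forall>x\<in>Field r. \<forall>y\<in>Field r. (x, y) \<in> r \<longleftrightarrow> h x \<le> h y))"

lemma ord_type_ordIso:
  assumes "(r, r') \<in> ordIso" "ord_type r' a"
  shows "ord_type r a"
proof -
  obtain f where f: "bij_betw f (Field r) (Field r')"
    "\<And>x y. x \<in> Field r \<Longrightarrow> y \<in> Field r \<Longrightarrow> (x, y) \<in> r \<longleftrightarrow> (f x, f y) \<in> r'"
    using assms(1) unfolding ordIso_def iso_iff2 by blast
  obtain h where h: "bij_betw h (Field r') {..<a}"
    "\<And>x y. x \<in> Field r' \<Longrightarrow> y \<in> Field r' \<Longrightarrow> (x, y) \<in> r' \<longleftrightarrow> h x \<le> h y"
    using assms(2) unfolding ord_type_def by blast
  have "f x \<in> Field r'" if "x \<in> Field r" for x using f(1) that by (auto simp: bij_betw_def)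
  then show ?thesis
    unfolding ord_type_def using f(2) h(2) bij_betw_trans[OF f(1) h(1)]
    by (intro exI[of _ "h \<circ> f"]) auto
qed

lemma ord_type_Well_order:
  assumes "ord_type r a"
  shows "Well_order r"
proof -
  obtain h where h: "bij_betw h (Field r) {..<a}"
    and iff: "\<And>x y. x \<in> Field r \<Longrightarrow> y \<in> Field r \<Longrightarrow> (x, y) \<in> r \<longleftrightarrow> h x \<le> h y"
    using assms unfolding ord_type_def by blast
  have F: "x \<in> Field r" "y \<in> Field r" if "(x, y) \<in> r" for x y
    using that by (auto simp: Field_def)
  have inj: "x = y" if "x \<in> Field r" "y \<in> Field r" "h x = h y" for x y
    using h that by (auto simp: bij_betw_def inj_on_def)
  have "r - Id \<subseteq> inv_image {(x, y). x < y} h"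
  proof
    fix p assume p: "p \<in> r - Id"
    obtain x y where xy: "p = (x, y)" by (cases p)
    then have "h x \<le> h y" "h x \<noteq> h y" using p F[of x y] iff[of x y] inj[of x y] by auto
    then show "p \<in> inv_image {(x, y). x < y} h" by (simp add: xy)
  qed
  then have "wf (r - Id)" by (rule wf_subset[rotated]) (simp add: wf)
  moreover have "refl_on (Field r) r" by (rule refl_onI) (simp add: iff)
  moreover have "trans r"
  proof (rule transI)
    fix x y z assume a: "(x, y) \<in> r" "(y, z) \<in> r"
    then have "h x \<le> h y" "h y \<le> h z" using iff F by blast+
    then show "(x, z) \<in> r" using iff[of x z] F[OF a(1)] F[OF a(2)] by auto
  qed
  moreover have "antisym r"
  proof (rule antisymI)
    fix x y assume a: "(x, y) \<in> r" "(y, x) \<in> r"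
    then have "h x \<le> h y" "h y \<le> h x" using iff F by blast+
    then show "x = y" using inj F[OF a(1)] by simp
  qed
  moreover have "total_on (Field r) r" unfolding total_on_def using iff by (meson linear)
  moreover have "r \<subseteq> Field r \<times> Field r" using F by auto
  ultimately show ?thesis
    unfolding well_order_on_def linear_order_on_def partial_order_on_def preorder_on_def by blast
qed

text \<open>A strictly increasing map on an initial segment satisfies \<open>x \<le> g x\<close>; at
  \<open>x = a'\<close> this would contradict \<open>g x < a'\<close>.\<close>

lemma strict_mono_into_le:
  fixes a a' :: "'o::wellorder"
  assumes "\<And>x. x < a \<Longrightarrow> g x < a'" "\<And>x y. x < y \<Longrightarrow> y < a \<Longrightarrow> g x < g y"
  shows "a \<le> a'"
proof (rule ccontr)
  assume "\<not> a \<le> a'"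
  have "x < a \<Longrightarrow> x \<le> g x" for x
  proof (induction x rule: less_induct)
    case (less x)
    show ?case
    proof (rule ccontr)
      assume "\<not> x \<le> g x"
      then have gx: "g x < x" by simp
      then have "g x < a" using less.prems by (rule order.strict_trans)
      then have "g x \<le> g (g x)" using less.IH[OF gx] by blast
      then show False using assms(2)[OF gx less.prems] by simp
    qed
  qed
  then show False using assms(1)[of a'] \<open>\<not> a \<le> a'\<close> by (meson not_le)
qed

lemma ord_type_mono:
  assumes "(r, r') \<in> ordLeq" "ord_type r (a::'o::wellorder)" "ord_type r' (a'::'o)"
  shows "a \<le> a'"
proof -
  obtain f where f: "embed r r' f" and wo: "Well_order r" "Well_order r'"
    using assms(1) unfolding ordLeq_def by blast
  obtain h where h: "bij_betw h (Field r) {..<a}"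
    "\<And>x y. x \<in> Field r \<Longrightarrow> y \<in> Field r \<Longrightarrow> (x, y) \<in> r \<longleftrightarrow> h x \<le> h y"
    using assms(2) unfolding ord_type_def by blast
  obtain h' where h': "bij_betw h' (Field r') {..<a'}"
    "\<And>x y. x \<in> Field r' \<Longrightarrow> y \<in> Field r' \<Longrightarrow> (x, y) \<in> r' \<longleftrightarrow> h' x \<le> h' y"
    using assms(3) unfolding ord_type_def by blast
  define g where "g = inv_into (Field r) h"
  have g: "g c \<in> Field r" "h (g c) = c" if "c < a" for c
    using that h(1) by (auto simp: g_def bij_betw_def intro!: inv_into_into f_inv_into_f)
  have fF: "f x \<in> Field r'" if "x \<in> Field r" for x
    using embed_Field[OF f] that by blast
  have finj: "inj_on f (Field r)" using embed_inj_on[OF wo(1) f] .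
  show ?thesis
  proof (rule strict_mono_into_le[where g = "\<lambda>c. h' (f (g c))"])
    fix c assume "c < a"
    then show "h' (f (g c)) < a'" using h'(1) fF g by (auto simp: bij_betw_def)
  next
    fix c d assume cd: "c < d" "d < a"
    then have c: "c < a" by (rule order.strict_trans)
    have "(g c, g d) \<in> r" using h(2) g cd c by simp
    then have "(f (g c), f (g d)) \<in> r'" using embed_compat[OF f] by (simp add: compat_def)
    then have le: "h' (f (g c)) \<le> h' (f (g d))" using h'(2) fF g cd c by simp
    have "g c \<noteq> g d" using g c cd by (metis less_irrefl)
    then have "f (g c) \<noteq> f (g d)" using finj g c cd by (simp add: inj_on_eq_iff)
    then have "h' (f (g c)) \<noteq> h' (f (g d))"
      using bij_betw_imp_inj_on[OF h'(1)] fF g(1)[OF c] g(1)[OF cd(2)] by (simp add: inj_on_eq_iff)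
    with le show "h' (f (g c)) < h' (f (g d))" by simp
  qed
qed

lemma ord_type_unique:
  assumes "(r, r') \<in> ordIso" "ord_type r (a::'o::wellorder)" "ord_type r' (a'::'o)"
  shows "a = a'"
  using ord_type_mono[OF ordIso_imp_ordLeq[OF assms(1)] assms(2,3)]
    ord_type_mono[OF ordIso_imp_ordLeq[OF ordIso_symmetric[OF assms(1)]] assms(3,2)] by simp

section \<open>Order types of powers of omega and of ordinal sums\<close>

lemma Field_omega_pow: "Field (omega_pow r) = omega_pow_carrier r"
  by (auto simp: omega_pow_def Field_def)

text \<open>A finitely supported \<open>f\<close> is the multiset in which the exponent
  \<open>h x\<close> has multiplicity \<open>f x\<close>. Both orders look at the largest place of
  difference, by \<open>less_multiset_iff_top\<close>.\<close>

lemma ord_type_omega_pow: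
  assumes "ord_type r a"
  shows "ord_type (omega_pow r) {#a#}"
proof -
  obtain h where h: "bij_betw h (Field r) {..<a}"
    and iff: "\<And>x y. x \<in> Field r \<Longrightarrow> y \<in> Field r \<Longrightarrow> (x, y) \<in> r \<longleftrightarrow> h x \<le> h y"
    using assms unfolding ord_type_def by blast
  define g where "g = inv_into (Field r) h"
  have g: "g c \<in> Field r" "h (g c) = c" if "c < a" for c
    using that h by (auto simp: g_def bij_betw_def intro!: inv_into_into f_inv_into_f)
  have gh: "g (h x) = x" if "x \<in> Field r" for x using that h by (auto simp: g_def bij_betw_def)
  have ha: "h x < a" if "x \<in> Field r" for x using that h by (auto simp: bij_betw_def)
  define H where "H f = Abs_multiset (\<lambda>c. if c < a then f (g c) else 0 :: nat)" for f
  have cnt: "count (H f) c = (if c < a then f (g c) else 0)" if f: "f \<in> omega_pow_carrier r" for f c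
  proof -
    have "{c. 0 < (if c < a then f (g c) else 0)} \<subseteq> h ` {x. f x \<noteq> 0}"
      using g by (force split: if_splits simp: image_iff)
    moreover have "finite (h ` {x. f x \<noteq> 0})" using f by (simp add: omega_pow_carrier_def)
    ultimately have "finite {c. 0 < (if c < a then f (g c) else 0)}" by (rule finite_subset)
    then show ?thesis unfolding H_def by (subst count_Abs_multiset) auto
  qed
  have cnth: "count (H f) (h x) = f x" if "f \<in> omega_pow_carrier r" "x \<in> Field r" for f x
    using cnt[OF that(1)] ha gh that(2) by simp
  have inj: "f = f'" if "f \<in> omega_pow_carrier r" "f' \<in> omega_pow_carrier r" "H f = H f'" for f f'
  proof
    fix x
    show "f x = f' x"
      using cnth[of f x] cnth[of f' x] that by (cases "x \<in> Field r") (auto simp: omega_pow_carrier_def)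
  qed
  have "bij_betw H (omega_pow_carrier r) {..<{#a#}}"
    unfolding bij_betw_def
  proof (intro conjI inj_onI equalityI subsetI)
    fix M assume "M \<in> H ` omega_pow_carrier r"
    then obtain f where f: "f \<in> omega_pow_carrier r" "M = H f" by blast
    have "c < a" if "c \<in># M" for c
      using that cnt[OF f(1), of c] f(2) by (metis count_eq_zero_iff)
    then show "M \<in> {..<{#a#}}" by simp
  next
    fix M assume M: "M \<in> {..<{#a#}}"
    define f where "f x = (if x \<in> Field r then count M (h x) else 0)" for x
    have "inj_on h (Field r)" using h by (simp add: bij_betw_def)
    then have "finite (Field r \<inter> h -` set_mset M)" 
      unfolding Int_commute[of "Field r"] by (intro finite_vimage_IntI) auto
    moreover have "{x. f x \<noteq> 0} \<subseteq> Field r \<inter> h -` set_mset M"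
      by (auto simp: f_def split: if_splits)
    ultimately have "finite {x. f x \<noteq> 0}" by (rule rev_finite_subset)
    then have f: "f \<in> omega_pow_carrier r" by (auto simp: omega_pow_carrier_def f_def)
    have "H f = M"
    proof (rule multiset_eqI)
      fix c
      show "count (H f) c = count M c"
      proof (cases "c < a")
        case True
        then show ?thesis using g cnt[OF f, of c] by (simp add: f_def)
      next
        case False
        then have "c \<notin># M" using M by auto
        then show ?thesis using False cnt[OF f, of c] by (simp add: not_in_iff)
      qed
    qed
    then show "M \<in> H ` omega_pow_carrier r" using f by blast
  qed (rule inj)
  moreover have "(f, f') \<in> omega_pow r \<longleftrightarrow> H f \<le> H f'"
    if f: "f \<in> omega_pow_carrier r" and f': "f' \<in> omega_pow_carrier r" for f f'
  proof -
    have "H f < H f' \<longleftrightarrow> (\<exists>x\<in>Field r. f x < f' x \<and> (\<forall>y\<in>Field r. (x, y) \<in> r \<and> y \<noteq> x \<longrightarrow> f y = f' y))"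
    proof
      assume "H f < H f'"
      then obtain c where c: "count (H f) c < count (H f') c" "\<And>d. d > c \<Longrightarrow> count (H f) d = count (H f') d"
        unfolding less_multiset_iff_top by blast
      have ca: "c < a" using c(1) cnt[OF f'] by (metis not_less0)
      have "f y = f' y" if y: "y \<in> Field r" "(g c, y) \<in> r" "y \<noteq> g c" for y
      proof -
        have "c \<le> h y" using iff[of "g c" y] g[OF ca] y by simp
        moreover have "c \<noteq> h y" using gh[OF y(1)] y(3) by auto
        ultimately have "count (H f) (h y) = count (H f') (h y)" using c(2) by simp
        then show ?thesis using cnth f f' y(1) by simp
      qed
      moreover have "f (g c) < f' (g c)" using c(1) cnt[OF f] cnt[OF f'] ca by simp
      ultimately show "\<exists>x\<in>Field r. f x < f' x \<and> (\<forall>y\<in>Field r. (x, y) \<in> r \<and> y \<noteq> x \<longrightarrow> f y = f' y)"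
        using g(1)[OF ca] by blast
    next
      assume "\<exists>x\<in>Field r. f x < f' x \<and> (\<forall>y\<in>Field r. (x, y) \<in> r \<and> y \<noteq> x \<longrightarrow> f y = f' y)"
      then obtain x where x: "x \<in> Field r" "f x < f' x"
        "\<And>y. y \<in> Field r \<Longrightarrow> (x, y) \<in> r \<Longrightarrow> y \<noteq> x \<Longrightarrow> f y = f' y" by blast
      have "count (H f) d = count (H f') d" if d: "d > h x" for d
      proof (cases "d < a")
        case True
        have "(x, g d) \<in> r" using iff[of x "g d"] g[OF True] x(1) d by simp
        moreover have "g d \<noteq> x" using g[OF True] d by auto
        ultimately have "f (g d) = f' (g d)" using x(3) g(1)[OF True] by blast
        then show ?thesis using cnt[OF f] cnt[OF f'] by simp
      next
        case False
        then show ?thesis using cnt[OF f] cnt[OF f'] by simp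
      qed
      moreover have "count (H f) (h x) < count (H f') (h x)" using cnth f f' x by simp
      ultimately show "H f < H f'" unfolding less_multiset_iff_top by blast
    qed
    moreover have "H f = H f' \<longleftrightarrow> f = f'" using inj f f' by blast
    ultimately show ?thesis using f f' by (auto simp: omega_pow_def le_less)
  qed
  ultimately show ?thesis unfolding ord_type_def Field_omega_pow by blast
qed

text \<open>Locates the summand of a descending sum in which \<open>M\<close> ends: while the
  leading exponent occurs in \<open>M\<close>, cancel it on both sides; otherwise all of
  \<open>M\<close> is below that exponent.\<close>

lemma less_mset_descendingE:
  fixes bs :: "'k::wellorder list"
  assumes "sorted_wrt (\<ge>) bs" "M < mset bs"
  obtains i z where "i < length bs" "z < {#bs ! i#}" "M = mset (take i bs) + z"
proof -
  have "\<exists>i<length bs. \<exists>z<{#bs ! i#}. M = mset (take i bs) + z"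
    using assms
  proof (induction bs arbitrary: M)
    case (Cons b bs)
    have le: "x \<le> b" if x: "x \<in># M" for x
    proof (rule ccontr)
      assume "\<not> x \<le> b"
      then have "mset (b # bs) < M"
        using x Cons.prems(1) by (intro ex_gt_imp_less_multiset exI[of _ x]) (auto intro: order.strict_trans1)
      then show False using Cons.prems(2) by simp
    qed
    show ?case
    proof (cases "b \<in># M")
      case False
      then have "\<forall>x\<in>#M. x < b" using le by (metis order.not_eq_order_implies_strict)
      then show ?thesis by (intro exI[of _ 0] conjI exI[of _ M]) auto
    next
      case True
      then obtain M' where M': "M = add_mset b M'" by (metis insert_DiffM)
      then have "M' < mset bs" using Cons.prems(2) by simp
      then obtain i z where "i < length bs" "z < {#bs ! i#}" "M' = mset (take i bs) + z"
        using Cons.IH[of M'] Cons.prems(1) unfolding sorted_wrt.simps(2) by blast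
      then show ?thesis using M' by (intro exI[of _ "Suc i"] conjI exI[of _ z]) auto
    qed
  qed simp
  then show ?thesis using that by blast
qed

text \<open>With descending exponents no term is absorbed, so the ordinary sum is the multiset of
  exponents.\<close>

lemma ord_type_ord_list_sum:
  fixes bs :: "'k::wellorder list"
  assumes len: "length rs = length bs" and desc: "sorted_wrt (\<ge>) bs"
    and ot: "\<And>i. i < length bs \<Longrightarrow> ord_type (rs ! i) {#bs ! i#}"
  shows "ord_type (ord_list_sum rs) (mset bs)"
proof -
  have "\<exists>h. bij_betw h (Field (rs ! i)) {..<{#bs ! i#}} \<and>
    (\<forall>x\<in>Field (rs ! i). \<forall>y\<in>Field (rs ! i). (x, y) \<in> rs ! i \<longleftrightarrow> h x \<le> h y)" if "i < length bs" for i
    using ot[OF that] unfolding ord_type_def .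
  then obtain h where h: "\<And>i. i < length bs \<Longrightarrow> bij_betw (h i) (Field (rs ! i)) {..<{#bs ! i#}}"
    and iff: "\<And>i x y. i < length bs \<Longrightarrow> x \<in> Field (rs ! i) \<Longrightarrow> y \<in> Field (rs ! i) \<Longrightarrow>
      (x, y) \<in> rs ! i \<longleftrightarrow> h i x \<le> h i y"
    by metis
  define S where "S = {(i, x). i < length bs \<and> x \<in> Field (rs ! i)}"
  have F: "Field (ord_list_sum rs) = S"
  proof
    show "Field (ord_list_sum rs) \<subseteq> S" by (auto simp: ord_list_sum_def Field_def S_def len)
    have "((i, x), (i, x)) \<in> ord_list_sum rs" if "i < length bs" "x \<in> Field (rs ! i)" for i x
      using that iff[of i x x] by (simp add: ord_list_sum_def len)
    then show "S \<subseteq> Field (ord_list_sum rs)" unfolding S_def Field_def by blast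
  qed
  have hi: "h i x < {#bs ! i#}" if "i < length bs" "x \<in> Field (rs ! i)" for i x
    using h[OF that(1)] that(2) unfolding bij_betw_def by blast
  \<comment> \<open>A point of block \<open>i\<close> goes to the sum of all earlier blocks plus its
    position in its own block.\<close>
  define H where "H = (\<lambda>(i, x). mset (take i bs) + h i x)"
  have lt_take: "H (i, x) < mset (take j bs)" if "i < j" "j \<le> length bs" "x \<in> Field (rs ! i)" for i j x
  proof -
    have "H (i, x) < mset (take i bs) + {#bs ! i#}"
      unfolding H_def prod.case using hi[of i x] that by (intro add_strict_left_mono) auto
    also have "\<dots> = mset (take (Suc i) bs)" using that by (simp add: take_Suc_conv_app_nth)
    also have "\<dots> \<le> mset (take j bs)"
    proof -
      have "take j bs = take (Suc i) bs @ take (j - Suc i) (drop (Suc i) bs)"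
        using that(1) by (metis Suc_leI le_add_diff_inverse take_add)
      then have "mset (take j bs) = mset (take (Suc i) bs) + mset (take (j - Suc i) (drop (Suc i) bs))"
        by (metis mset_append)
      then show ?thesis by (metis less_eq_multiset_plus_right)
    qed
    finally show ?thesis .
  qed
  have lt: "H (i, x) < H (j, y)" if "i < j" "j < length bs" "x \<in> Field (rs ! i)" for i j x y
  proof -
    have "H (i, x) < mset (take j bs)" using lt_take that by simp
    also have "\<dots> \<le> H (j, y)" by (simp add: H_def)
    finally show ?thesis .
  qed
  have ord: "(p, q) \<in> ord_list_sum rs \<longleftrightarrow> H p \<le> H q" if pq: "p \<in> S" "q \<in> S" for p q
  proof -
    obtain i x j y where e: "p = (i, x)" "q = (j, y)" by (cases p, cases q)
    have b: "i < length bs" "j < length bs" "x \<in> Field (rs ! i)" "y \<in> Field (rs ! j)"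
      using pq by (auto simp: S_def e)
    consider "i < j" | "j < i" | "i = j" by linarith
    then show ?thesis
    proof cases
      case 1
      then show ?thesis using lt[OF 1 b(2,3), of y] b by (simp add: ord_list_sum_def e len)
    next
      case 2
      then show ?thesis using lt[OF 2 b(1,4), of x] b by (simp add: ord_list_sum_def e len)
    next
      case 3
      then show ?thesis using iff[OF b(1,3)] b by (simp add: ord_list_sum_def e len H_def)
    qed
  qed
  have "inj_on H S"
  proof (rule inj_onI)
    fix p q assume pq: "p \<in> S" "q \<in> S" "H p = H q"
    obtain i x j y where e: "p = (i, x)" "q = (j, y)" by (cases p, cases q)
    have b: "i < length bs" "j < length bs" "x \<in> Field (rs ! i)" "y \<in> Field (rs ! j)"
      using pq by (auto simp: S_def e)
    have "i = j" using lt[of i j x y] lt[of j i y x] b pq(3) unfolding e by (metis less_irrefl linorder_neqE_nat)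
    moreover have "h i x = h j y" using pq(3) calculation by (simp add: e H_def)
    ultimately show "p = q" using h[OF b(1)] b by (auto simp: e bij_betw_def inj_on_eq_iff)
  qed
  moreover have "H ` S = {..<mset bs}"
  proof (intro equalityI subsetI)
    fix M assume "M \<in> H ` S"
    then obtain i x where "i < length bs" "x \<in> Field (rs ! i)" "M = H (i, x)" by (auto simp: S_def)
    then show "M \<in> {..<mset bs}" using lt_take[of i "length bs" x] by simp
  next
    fix M assume "M \<in> {..<mset bs}"
    then have "M < mset bs" by simp
    then obtain i z where iz: "i < length bs" "z < {#bs ! i#}" "M = mset (take i bs) + z"
      by (rule less_mset_descendingE[OF desc])
    then obtain x where "x \<in> Field (rs ! i)" "z = h i x" using h[OF iz(1)] unfolding bij_betw_def by blast
    then show "M \<in> H ` S" using iz by (force simp: S_def H_def image_iff)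
  qed
  ultimately show ?thesis unfolding ord_type_def F using ord by (auto simp: bij_betw_def)
qed

text \<open>The ordinary sum 1 + \<open>d\<close>, in which an infinite \<open>d\<close> absorbs the
  1.\<close>

definition one_plus :: "'k::wellorder multiset \<Rightarrow> 'k multiset" where
  "one_plus d = (if fin_ord d then add_mset zero_exp d else d)"

lemma one_plus_less: "c < d \<Longrightarrow> one_plus c < one_plus d"
proof -
  assume cd: "c < d"
  show ?thesis
  proof (cases "fin_ord d")
    case True
    then show ?thesis using cd fin_ord_le[of c d] by (simp add: one_plus_def)
  next
    case False
    have "add_mset zero_exp c < d" if "fin_ord c"
      using that False by (intro fin_ord_less_infinite) (auto simp: fin_ord_def)
    then show ?thesis using False cd by (simp add: one_plus_def)
  qed
qed

lemma one_plus_less_iff: "one_plus c < one_plus d \<longleftrightarrow> c < d"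
  by (metis one_plus_less less_asym less_irrefl linorder_neqE)

lemma one_plus_surj: "w \<noteq> {#} \<Longrightarrow> \<exists>c. w = one_plus c"
proof -
  assume w: "w \<noteq> {#}"
  show ?thesis
  proof (cases "fin_ord w")
    case True
    then obtain w' where "w = add_mset zero_exp w'"
      using w unfolding fin_ord_def by (metis insert_DiffM multiset_nonemptyE singletonD subsetD)
    then show ?thesis using True by (intro exI[of _ w']) (auto simp: one_plus_def fin_ord_def)
  qed (auto simp: one_plus_def)
qed

text \<open>The new least element goes to 0 and \<open>x\<close> to 1 + \<open>h x\<close>; this is
  onto because every nonzero ordinal is of the form 1 + \<open>c\<close>.\<close>

lemma ord_type_one_plus:
  assumes "ord_type \<delta> d"
  shows "ord_type (ord_sum ord_one \<delta>) (one_plus d)"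
proof -
  obtain h where h: "bij_betw h (Field \<delta>) {..<d}"
    and iff: "\<And>x y. x \<in> Field \<delta> \<Longrightarrow> y \<in> Field \<delta> \<Longrightarrow> (x, y) \<in> \<delta> \<longleftrightarrow> h x \<le> h y"
    using assms unfolding ord_type_def by blast
  define H where "H p = (case p of Inl (_::unit) \<Rightarrow> {#} | Inr x \<Rightarrow> one_plus (h x))" for p
  have F1: "Field ord_one = {()}" by (auto simp: ord_one_def Field_def)
  have F: "Field (ord_sum ord_one \<delta>) = insert (Inl ()) (Inr ` Field \<delta>)"
  proof (intro equalityI subsetI)
    fix p assume "p \<in> Field (ord_sum ord_one \<delta>)"
    then show "p \<in> insert (Inl ()) (Inr ` Field \<delta>)"
      unfolding ord_sum_def F1 by (auto simp: Field_def ord_one_def)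
  next
    fix p assume "p \<in> insert (Inl ()) (Inr ` Field \<delta>)"
    then consider "p = Inl ()" | x where "p = Inr x" "x \<in> Field \<delta>" by auto
    then show "p \<in> Field (ord_sum ord_one \<delta>)"
    proof cases
      case 1
      have "(Inl (), Inl ()) \<in> ord_sum ord_one \<delta>" by (simp add: ord_sum_def ord_one_def)
      then show ?thesis using 1 by (auto simp: Field_def)
    next
      case 2
      have "(Inl (), Inr x) \<in> ord_sum ord_one \<delta>" using 2 by (simp add: ord_sum_def F1)
      then show ?thesis using 2 unfolding Field_def by blast
    qed
  qed
  have ne: "one_plus c \<noteq> {#}" for c :: "'b multiset" by (auto simp: one_plus_def fin_ord_def)
  have le_iff: "one_plus x \<le> one_plus y \<longleftrightarrow> x \<le> y" for x y :: "'b multiset"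
    by (metis not_le one_plus_less_iff)
  have hd: "h x < d" if "x \<in> Field \<delta>" for x using h that by (auto simp: bij_betw_def)
  have "bij_betw H (Field (ord_sum ord_one \<delta>)) {..<one_plus d}"
    unfolding bij_betw_def F
  proof (intro conjI equalityI subsetI)
    have "inj_on h (Field \<delta>)" using h by (simp add: bij_betw_def)
    moreover have "one_plus x = one_plus y \<longleftrightarrow> x = y" for x y :: "'b multiset"
      using le_iff by (metis order.eq_iff)
    ultimately show "inj_on H (insert (Inl ()) (Inr ` Field \<delta>))"
      using ne by (auto simp: inj_on_def H_def split: sum.splits)
  next
    fix w assume "w \<in> H ` insert (Inl ()) (Inr ` Field \<delta>)"
    then show "w \<in> {..<one_plus d}" using hd ne by (auto simp: H_def one_plus_less_iff)
  next
    fix w assume w: "w \<in> {..<one_plus d}"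
    show "w \<in> H ` insert (Inl ()) (Inr ` Field \<delta>)"
    proof (cases "w = {#}")
      case True
      then show ?thesis by (simp add: H_def)
    next
      case False
      then obtain c where c: "w = one_plus c" using one_plus_surj by blast
      then have "c < d" using w by (simp add: one_plus_less_iff)
      then obtain x where "x \<in> Field \<delta>" "c = h x" using h unfolding bij_betw_def by blast
      then show ?thesis using c by (auto simp: H_def image_iff)
    qed
  qed
  moreover have "(p, q) \<in> ord_sum ord_one \<delta> \<longleftrightarrow> H p \<le> H q"
    if "p \<in> Field (ord_sum ord_one \<delta>)" "q \<in> Field (ord_sum ord_one \<delta>)" for p q
    using that iff ne unfolding F
    by (auto simp: ord_sum_def F1 ord_one_def H_def le_iff)
  ultimately show ?thesis unfolding ord_type_def by blast
qed

section \<open>Cantor normal forms of arbitrary well-orders\<close>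

text \<open>A well-ordered type with more elements than \<^typ>\<open>'u\<close>, so that every ordinal carried by a
  subset of \<^typ>\<open>'u\<close> is an initial segment of it.\<close>

typedef 'u ordinal_index = "UNIV :: 'u set set" by simp

instantiation ordinal_index :: (type) wellorder
begin

definition less_eq_ordinal_index :: "'a ordinal_index \<Rightarrow> 'a ordinal_index \<Rightarrow> bool" where
  "less_eq_ordinal_index x y \<longleftrightarrow> (Rep_ordinal_index x, Rep_ordinal_index y) \<in> card_of UNIV"

definition less_ordinal_index :: "'a ordinal_index \<Rightarrow> 'a ordinal_index \<Rightarrow> bool" where
  "less_ordinal_index x y \<longleftrightarrow> x \<le> y \<and> x \<noteq> y"

instance
proof
  let ?r = "card_of (UNIV :: 'a set set)"
  have wo: "well_order_on UNIV ?r" by (rule card_of_well_order_on)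
  then have r: "refl_on UNIV ?r" "trans ?r" "antisym ?r" "total_on UNIV ?r" "wf (?r - Id)"
    by (auto simp: well_order_on_def linear_order_on_def partial_order_on_def preorder_on_def)
  fix x y z :: "'a ordinal_index"
  show "x \<le> x" using r(1) by (simp add: less_eq_ordinal_index_def refl_on_def)
  show "x \<le> y \<Longrightarrow> y \<le> z \<Longrightarrow> x \<le> z"
    using r(2) unfolding less_eq_ordinal_index_def by (rule transD)
  show antisym: "x \<le> y \<Longrightarrow> y \<le> x \<Longrightarrow> x = y" for x y :: "'a ordinal_index"
    using r(3) unfolding less_eq_ordinal_index_def by (metis Rep_ordinal_index_inject antisymD)
  show "x < y \<longleftrightarrow> x \<le> y \<and> \<not> y \<le> x"
    using antisym \<open>x \<le> x\<close> by (auto simp: less_ordinal_index_def)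
  show "x \<le> y \<or> y \<le> x"
    using r(1,4) unfolding less_eq_ordinal_index_def total_on_def refl_on_def by (metis UNIV_I)
  fix P :: "'a ordinal_index \<Rightarrow> bool" and a
  assume step: "\<And>x. (\<And>y. y < x \<Longrightarrow> P y) \<Longrightarrow> P x"
  have "wf (inv_image (?r - Id) Rep_ordinal_index)" using r(5) by (rule wf_inv_image)
  then show "P a"
  proof (induction a rule: wf_induct_rule)
    case (less x)
    show ?case
      by (rule step, rule less)
        (auto simp: less_ordinal_index_def less_eq_ordinal_index_def Rep_ordinal_index_inject)
  qed
qed

end

text \<open>By Cantor's theorem the index type cannot embed into \<open>k\<close>, whose points
  inject into \<open>'u\<close>. Comparability of well-orders then makes \<open>k\<close> a proper
  initial segment of the index type.\<close>

lemma ex_ord_type_ordinal_index: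
  fixes k :: "'x rel" and g :: "'x \<Rightarrow> 'u"
  assumes wo: "Well_order k" and g: "inj g"
  shows "\<exists>b :: 'u ordinal_index. ord_type k b"
proof -
  define R where "R = {(x, y :: 'u ordinal_index). x \<le> y}"
  have FR: "Field R = UNIV" by (auto simp: R_def Field_def)
  have "R - Id = {(x, y). x < y}" by (auto simp: R_def)
  then have "wf (R - Id)" using wf by simp
  moreover have "refl R" "total R" by (auto simp: R_def refl_on_def total_on_def)
  moreover have "trans R" by (rule transI) (auto simp: R_def)
  moreover have "antisym R" by (rule antisymI) (auto simp: R_def)
  ultimately have woR: "Well_order R"
    unfolding well_order_on_def linear_order_on_def partial_order_on_def preorder_on_def FR by simp
  have "\<not> (R, k) \<in> ordLeq"
  proof
    assume "(R, k) \<in> ordLeq"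
    then obtain f where "embed R k f" unfolding ordLeq_def by blast
    then have "inj f" using embed_inj_on[OF woR] FR by metis
    \<comment> \<open>Such an embedding would inject the subsets of \<open>'u\<close> into
      \<open>'u\<close>.\<close>
    then have "inj (\<lambda>A. g (f (Abs_ordinal_index A)))"
      using g unfolding inj_def by (metis Abs_ordinal_index_inject UNIV_I)
    then have "surj (inv (\<lambda>A :: 'u set. g (f (Abs_ordinal_index A))))" by (rule inj_imp_surj_inv)
    then show False using Cantors_theorem[of "UNIV :: 'u set"] by auto
  qed
  then have "(k, R) \<in> ordLess" using wo woR by (simp add: not_ordLeq_iff_ordLess)
  then obtain a where a: "(k, Restr R (underS R a)) \<in> ordIso"
    using ordLess_iff_ordIso_Restr[OF woR wo] by blast
  have "underS R a = {..<a}" by (auto simp: underS_def R_def)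
  moreover have "ord_type (Restr R {..<a}) a"
  proof -
    have "Field (Restr R {..<a}) = {..<a}" by (auto simp: R_def Field_def)
    then show ?thesis unfolding ord_type_def by (intro exI[of _ id]) (auto simp: R_def)
  qed
  ultimately show ?thesis using ord_type_ordIso[OF a] by auto
qed

definition ordinal_index_of :: "'x rel \<Rightarrow> 'o::wellorder" where
  "ordinal_index_of k = (SOME b. ord_type k b)"

definition cnf_value :: "'x rel list \<Rightarrow> 'o::wellorder multiset" where
  "cnf_value ks = mset (map ordinal_index_of ks)"

lemma ord_type_ordinal_index_of:
  fixes k :: "'x rel" and g :: "'x \<Rightarrow> 'u"
  assumes "Well_order k" "inj g"
  shows "ord_type k (ordinal_index_of k :: 'u ordinal_index)"
  unfolding ordinal_index_of_def using ex_ord_type_ordinal_index[OF assms] by (rule someI_ex)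

lemma ord_type_cnf_value:
  fixes \<alpha> :: "'x rel" and g :: "'x \<Rightarrow> 'u"
  assumes cnf: "is_cnf \<alpha> ks" and g: "inj g"
  shows "ord_type \<alpha> (cnf_value ks :: 'u ordinal_index multiset)"
proof -
  let ?o = "ordinal_index_of :: 'x rel \<Rightarrow> 'u ordinal_index"
  have ot: "ord_type k (?o k)" if "k \<in> set ks" for k
    using ord_type_ordinal_index_of[OF _ g] cnf that by (simp add: is_cnf_def)
  have "sorted_wrt (\<ge>) (map ?o ks)"
    unfolding sorted_wrt_iff_nth_less
  proof (intro allI impI)
    fix i j assume ij: "i < j" "j < length (map ?o ks)"
    then have "(ks ! j, ks ! i) \<in> ordLeq" using cnf by (simp add: is_cnf_def nonincreasing_ords_def)
    then show "map ?o ks ! j \<le> map ?o ks ! i" using ij ot by (simp add: ord_type_mono)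
  qed
  then have "ord_type (ord_list_sum (map omega_pow ks)) (mset (map ?o ks))"
    using ot by (intro ord_type_ord_list_sum) (auto intro: ord_type_omega_pow)
  then show ?thesis using cnf ord_type_ordIso unfolding is_cnf_def cnf_value_def by blast
qed

text \<open>Isomorphic exponents receive the same index because order types in one index type are
  unique; the injections \<open>g\<close> and \<open>g'\<close> into a common \<open>'u\<close> make
  the two index types agree.\<close>

lemma cnf_value_rearrangement:
  fixes g :: "'x \<Rightarrow> 'u" and g' :: "'y \<Rightarrow> 'u" and ms :: "'y rel list" and ks :: "'x rel list"
  assumes re: "ord_rearrangement ms ks" and g: "inj g" "inj g'"
    and wo: "\<forall>k\<in>set ks. Well_order k" "\<forall>m\<in>set ms. Well_order m"
  shows "(cnf_value ms :: 'u ordinal_index multiset) = cnf_value ks"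
proof -
  let ?o = "ordinal_index_of :: 'x rel \<Rightarrow> 'u ordinal_index"
  let ?o' = "ordinal_index_of :: 'y rel \<Rightarrow> 'u ordinal_index"
  obtain \<pi> where \<pi>: "bij_betw \<pi> {..<length ms} {..<length ks}"
    "\<And>i. i < length ms \<Longrightarrow> (ms ! i, ks ! \<pi> i) \<in> ordIso"
    using re unfolding ord_rearrangement_def by blast
  have eq: "?o' (ms ! i) = ?o (ks ! \<pi> i)" if i: "i < length ms" for i
  proof -
    have "\<pi> i < length ks" using \<pi>(1) i by (auto simp: bij_betw_def)
    then show ?thesis
      using \<pi>(2)[OF i] ord_type_ordinal_index_of[OF _ g(1), of "ks ! \<pi> i"]
        ord_type_ordinal_index_of[OF _ g(2), of "ms ! i"] wo i by (intro ord_type_unique) auto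
  qed
  have nth: "mset xs = image_mset (nth xs) (mset_set {..<length xs})" for xs :: "'z rel list"
    by (metis map_nth mset_map mset_upt lessThan_atLeast0)
  have "cnf_value ms = image_mset (\<lambda>i. ?o' (ms ! i)) (mset_set {..<length ms})"
    unfolding cnf_value_def mset_map nth[of ms] by (simp add: multiset.map_comp o_def)
  also have "\<dots> = image_mset (\<lambda>i. ?o (ks ! \<pi> i)) (mset_set {..<length ms})"
    by (rule image_mset_cong) (simp add: eq)
  also have "\<dots> = image_mset (\<lambda>i. ?o (ks ! i)) (image_mset \<pi> (mset_set {..<length ms}))"
    by (simp add: multiset.map_comp o_def)
  also have "image_mset \<pi> (mset_set {..<length ms}) = mset_set {..<length ks}"
    using \<pi>(1) by (simp add: bij_betw_def image_mset_mset_set)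
  also have "image_mset (\<lambda>i. ?o (ks ! i)) (mset_set {..<length ks}) = cnf_value ks"
    unfolding cnf_value_def mset_map nth[of ks] by (simp add: multiset.map_comp o_def)
  finally show ?thesis .
qed

lemma cnf_value_concat: "cnf_value (concat kss) = sum_list (map cnf_value kss)"
  by (induction kss) (auto simp: cnf_value_def)

lemma is_cnf_Well_orders: "is_cnf \<alpha> ks \<Longrightarrow> k \<in> set ks \<Longrightarrow> Well_order k"
  by (simp add: is_cnf_def)

text \<open>Concatenating normal forms adds their multisets of exponents, and a rearrangement does
  not change the multiset.\<close>

lemma ord_type_nat_sum:
  fixes g :: "'x \<Rightarrow> 'u" and g' :: "'y \<Rightarrow> 'u" and as :: "'x rel list" and \<gamma> :: "'y rel"
  assumes ns: "is_nat_sum as \<gamma>" and g: "inj g" "inj g'"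
  shows "\<exists>a :: 'u ordinal_index multiset list. length a = length as \<and>
    (\<forall>i<length as. ord_type (as ! i) (a ! i)) \<and> ord_type \<gamma> (sum_list a)"
proof -
  obtain kss ms where k: "length kss = length as" "\<And>i. i < length as \<Longrightarrow> is_cnf (as ! i) (kss ! i)"
    "is_cnf \<gamma> ms" "ord_rearrangement ms (concat kss)"
    using ns unfolding is_nat_sum_def by blast
  have wo: "Well_order k'" if k': "k' \<in> set (concat kss)" for k'
  proof -
    obtain ks where ks: "ks \<in> set kss" "k' \<in> set ks" using k' by auto
    then obtain i where "i < length kss" "ks = kss ! i" by (metis in_set_conv_nth)
    then show ?thesis using k(1,2) ks(2) is_cnf_Well_orders by metis
  qed
  have "(cnf_value ms :: 'u ordinal_index multiset) = cnf_value (concat kss)"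
    using wo is_cnf_Well_orders[OF k(3)] by (intro cnf_value_rearrangement[OF k(4) g]) auto
  then have "ord_type \<gamma> (sum_list (map cnf_value kss :: 'u ordinal_index multiset list))"
    using ord_type_cnf_value[OF k(3) g(2)] by (simp add: cnf_value_concat)
  then show ?thesis
    using k(1,2) ord_type_cnf_value[OF _ g(1)] by (intro exI[of _ "map cnf_value kss"]) auto
qed

section \<open>Width of the product in terms of the given well-orders\<close>

lemma ord_type_inj_image:
  assumes "inj f" "ord_type (map_prod f f ` r) a"
  shows "ord_type r a"
proof -
  have F: "Field (map_prod f f ` r) = f ` Field r" by (force simp: Field_def image_iff Domain_iff Range_iff)
  obtain h where h: "bij_betw h (f ` Field r) {..<a}"
    "\<And>x y. x \<in> f ` Field r \<Longrightarrow> y \<in> f ` Field r \<Longrightarrow> (x, y) \<in> map_prod f f ` r \<longleftrightarrow> h x \<le> h y"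
    using assms(2) unfolding ord_type_def F by blast
  have "bij_betw f (Field r) (f ` Field r)" using assms(1) by (auto simp: bij_betw_def inj_on_def inj_def)
  then have "bij_betw (h \<circ> f) (Field r) {..<a}" using h(1) by (rule bij_betw_trans)
  moreover have "(x, y) \<in> r \<longleftrightarrow> (f x, f y) \<in> map_prod f f ` r" for x y
    using assms(1) by (auto simp: inj_def)
  ultimately show ?thesis unfolding ord_type_def using h(2) by (intro exI[of _ "h \<circ> f"]) auto
qed

text \<open>Matches the symmetric \<open>width_exp\<close> with the stated exponent,
  \<open>d\<close> being the tail sum minus 1. If \<open>d\<close> is finite, so is the whole tail,
  and one 1 is removed; if \<open>d\<close> is infinite, some tail coordinate is infinite, hence so
  is the larger first one, and nothing is removed.\<close>

lemma width_exp_hd: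
  fixes a :: "'k::wellorder multiset list"
  assumes len: "a \<noteq> []" and desc: "\<And>i. i < length a \<Longrightarrow> a ! i \<le> a ! 0"
    and i: "0 < i" "i < length a" "a ! i \<noteq> {#}" and d: "sum_list (tl a) = one_plus d"
  shows "width_exp a = hd a + d"
proof -
  have sum: "sum_list a = a ! 0 + one_plus d"
    using len d by (cases a) auto
  have "a ! 0 \<noteq> {#}" using desc[OF i(2)] i(3) by auto
  then have nz: "two_nonzero a" using i by (intro two_nonzeroI[of i _ 0]) auto
  have hd: "hd a = a ! 0" using len by (simp add: hd_conv_nth)
  have tl_nth: "tl a ! (k - 1) = a ! k" if "0 < k" "k < length a" for k
    using that by (simp add: nth_tl)
  show ?thesis
  proof (cases "fin_ord d")
    case True
    then have "fin_ord (sum_list (tl a))" by (simp add: d one_plus_def fin_ord_def)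
    then have fin: "fin_ord (a ! k)" if "0 < k" "k < length a" for k
    proof -
      have "x = zero_exp" if "x \<in># a ! k" for x
      proof -
        have "x \<in># tl a ! (k - 1)" "k - 1 < length (tl a)"
          using that tl_nth[of k] \<open>0 < k\<close> \<open>k < length a\<close> by auto
        then have "x \<in># sum_list (tl a)" unfolding mem_sum_list_mset by blast
        then show ?thesis using \<open>fin_ord (sum_list (tl a))\<close> by (auto simp: fin_ord_def)
      qed
      then show ?thesis by (auto simp: fin_ord_def)
    qed
    have "\<not> two_infinite a" unfolding two_infinite_def using fin by (metis neq0_conv)
    then show ?thesis using nz True sum by (simp add: width_exp_def hd one_plus_def)
  next
    case False
    then obtain x where x: "x \<in># sum_list (tl a)" "x \<noteq> zero_exp"
      using d by (auto simp: fin_ord_def one_plus_def)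
    then obtain k where k: "k < length (tl a)" "x \<in># tl a ! k" unfolding mem_sum_list_mset by blast
    have "\<not> fin_ord (a ! Suc k)" using k x(2) by (auto simp: nth_tl fin_ord_def)
    moreover have "\<not> fin_ord (a ! 0)" using calculation desc[of "Suc k"] k(1) fin_ord_le[of "a ! Suc k" "a ! 0"] by auto
    ultimately have "two_infinite a" using k(1) by (intro two_infiniteI[of "Suc k" _ 0]) auto
    then show ?thesis using nz False sum by (simp add: width_exp_def hd one_plus_def)
  qed
qed

text \<open>The coordinatewise order types form an isomorphism \<open>H\<close> from the product
  onto \<open>box a\<close>, with inverse \<open>G\<close>; it transports the upper and
  \<open>G\<close> the lower bound.\<close>

lemma width_is_prod_omega_pow:
  fixes a :: "'k::wellorder multiset list"
  assumes len: "length a = length \<alpha>s" and ot: "\<And>i. i < length a \<Longrightarrow> ord_type (\<alpha>s ! i) (a ! i)"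
    and e: "ord_type \<epsilon> (width_exp a)"
  shows "width_is (prod_carrier (map omega_pow \<alpha>s)) (prod_le (map omega_pow \<alpha>s)) (omega_pow \<epsilon>)"
proof -
  let ?X = "prod_carrier (map omega_pow \<alpha>s)" and ?le = "prod_le (map omega_pow \<alpha>s)"
  let ?W = "\<lambda>i. omega_pow (\<alpha>s ! i)"
  have "\<exists>h. bij_betw h (Field (?W i)) {..<{#a ! i#}} \<and>
    (\<forall>x\<in>Field (?W i). \<forall>y\<in>Field (?W i). (x, y) \<in> ?W i \<longleftrightarrow> h x \<le> h y)" if "i < length a" for i
    using ord_type_omega_pow[OF ot[OF that]] unfolding ord_type_def .
  then obtain h where h: "\<And>i. i < length a \<Longrightarrow> bij_betw (h i) (Field (?W i)) {..<{#a ! i#}}"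
    and iff: "\<And>i x y. i < length a \<Longrightarrow> x \<in> Field (?W i) \<Longrightarrow> y \<in> Field (?W i) \<Longrightarrow>
      (x, y) \<in> ?W i \<longleftrightarrow> h i x \<le> h i y"
    by metis
  define H where "H xs = map (\<lambda>i. h i (xs ! i)) [0..<length a]" for xs
  define G where "G ys = map (\<lambda>i. inv_into (Field (?W i)) (h i) (ys ! i)) [0..<length a]" for ys
  have X: "xs \<in> ?X \<longleftrightarrow> length xs = length a \<and> (\<forall>i<length a. xs ! i \<in> Field (?W i))" for xs
    by (auto simp: prod_carrier_def len)
  have HX: "H xs \<in> box a" if "xs \<in> ?X" for xs
    using that h unfolding X box_def H_def bij_betw_def by (auto simp del: mset_lt_single_right_iff)
  have GX: "G ys \<in> ?X" and HG: "H (G ys) = ys" if ys: "ys \<in> box a" for ys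
  proof -
    have "ys ! i \<in> h i ` Field (?W i)" if "i < length a" for i
      using ys h[OF that] that unfolding box_def bij_betw_def by (auto simp del: mset_lt_single_right_iff)
    then show "G ys \<in> ?X" "H (G ys) = ys"
      using ys unfolding X G_def H_def box_def
      by (auto simp: inv_into_into f_inv_into_f intro!: nth_equalityI)
  qed
  have le_iff: "?le xs ys \<longleftrightarrow> list_all2 (\<le>) (H xs) (H ys)" if "xs \<in> ?X" "ys \<in> ?X" for xs ys
    using that iff unfolding X by (auto simp: prod_le_def len[symmetric] H_def list_all2_conv_all_nth)
  have inc: "incomparable ?le xs ys \<longleftrightarrow> incomparable (list_all2 (\<le>)) (H xs) (H ys)"
    if "xs \<in> ?X" "ys \<in> ?X" for xs ys
    using le_iff that by (simp add: incomparable_def)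
  have "width_ge ?le ?X {#width_exp a#}"
    by (rule width_ge_image[OF width_ge_box, of a G]) (use GX HG inc in auto)
  moreover have "width_le ?le ?X {#width_exp a#}"
    by (rule width_le_image[OF width_le_box, of _ H]) (use HX inc in auto)
  moreover obtain k where "bij_betw k (Field (omega_pow \<epsilon>)) {..<{#width_exp a#}}"
    "\<And>x y. x \<in> Field (omega_pow \<epsilon>) \<Longrightarrow> y \<in> Field (omega_pow \<epsilon>) \<Longrightarrow> (x, y) \<in> omega_pow \<epsilon> \<longleftrightarrow> k x \<le> k y"
    using ord_type_omega_pow[OF e] unfolding ord_type_def by blast
  ultimately show ?thesis
    using ord_type_Well_order[OF ord_type_omega_pow[OF e]] by (intro forest_rank_antichain_seqs)
qed

text \<open>In a chain every residual after one move is empty, so the forest consists of isolated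
  roots; \<open>nat\<close> is large enough for the value 1.\<close>

lemma width_is_chain:
  assumes "A \<noteq> {}" "\<And>x y. x \<in> A \<Longrightarrow> y \<in> A \<Longrightarrow> \<not> incomparable le x y"
  shows "width_is A le ord_one"
proof (rule forest_rank_antichain_seqs[where \<zeta> = "1 :: nat" and h = "\<lambda>_. 0"])
  have ge: "width_ge le B (0 :: nat)" for B by (rule width_geI) simp
  show "width_ge le A (1 :: nat)" by (rule width_geI) (use assms(1) ge in auto)
  have "residual le A [x] = {}" if "x \<in> A" for x using that assms(2) by (auto simp: residual_def)
  moreover have "width_le le {} (0 :: nat)" by (rule width_leI) simp
  ultimately show "width_le le A (1 :: nat)" by (intro width_leI) auto
  show "Well_order ord_one"
    by (auto simp: ord_one_def Field_def well_order_on_def linear_order_on_def partial_order_on_def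
        preorder_on_def refl_on_def trans_def antisym_def total_on_def)
qed (auto simp: ord_one_def Field_def bij_betw_def)

theorem mainTheorem9:
  fixes \<alpha>s :: "'a rel list"
  assumes n_pos: "length \<alpha>s \<ge> 1"
    and wo: "\<forall>i<length \<alpha>s. Well_order (\<alpha>s ! i)"
    and decr: "\<forall>i. Suc i < length \<alpha>s \<longrightarrow> (\<alpha>s ! Suc i, \<alpha>s ! i) \<in> ordLeq"
  shows "((\<forall>i. 1 \<le> i \<and> i < length \<alpha>s \<longrightarrow> (\<alpha>s ! i, {} :: 'a rel) \<in> ordIso) \<longrightarrow>
            width_is (prod_carrier (map omega_pow \<alpha>s)) (prod_le (map omega_pow \<alpha>s)) ord_one)
       \<and> (\<not> (\<forall>i. 1 \<le> i \<and> i < length \<alpha>s \<longrightarrow> (\<alpha>s ! i, {} :: 'a rel) \<in> ordIso) \<longrightarrow>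
            (\<forall>(\<sigma> :: 'b rel) (\<delta> :: 'c rel) (\<epsilon> :: 'd rel).
               is_nat_sum (tl \<alpha>s) \<sigma> \<and> Well_order \<delta> \<and> (ord_sum ord_one \<delta>, \<sigma>) \<in> ordIso \<and>
               is_nat_sum2 (hd \<alpha>s) \<delta> \<epsilon>
               \<longrightarrow> width_is (prod_carrier (map omega_pow \<alpha>s)) (prod_le (map omega_pow \<alpha>s))
                     (omega_pow \<epsilon>)))"
proof (intro conjI impI allI)
  assume zero: "\<forall>i. 1 \<le> i \<and> i < length \<alpha>s \<longrightarrow> (\<alpha>s ! i, {} :: 'a rel) \<in> ordIso"
  let ?Ws = "map omega_pow \<alpha>s"
  have empty: "Field (\<alpha>s ! i) = {}" if "1 \<le> i" "i < length \<alpha>s" for i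
  proof -
    have "(\<alpha>s ! i, {} :: 'a rel) \<in> ordIso" using zero that by blast
    then obtain f where "bij_betw f (Field (\<alpha>s ! i)) (Field ({} :: 'a rel))"
      unfolding ordIso_def iso_iff2 by blast
    then show ?thesis by (simp add: bij_betw_def)
  qed
  have W: "Well_order (omega_pow (\<alpha>s ! i))" if "i < length \<alpha>s" for i
  proof -
    have "Well_order (\<alpha>s ! i)" using wo that by blast
    then obtain b :: "'a ordinal_index" where "ord_type (\<alpha>s ! i) b"
      using ex_ord_type_ordinal_index[of _ id] by auto
    then show ?thesis by (intro ord_type_Well_order[OF ord_type_omega_pow])
  qed
  have refl: "(x, x) \<in> omega_pow (\<alpha>s ! i)" if "x \<in> Field (omega_pow (\<alpha>s ! i))" for i x
    using that unfolding Field_omega_pow by (simp add: omega_pow_def)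
  show "width_is (prod_carrier ?Ws) (prod_le ?Ws) ord_one"
  proof (rule width_is_chain)
    have "replicate (length \<alpha>s) (\<lambda>_. 0) \<in> prod_carrier ?Ws"
      by (simp add: prod_carrier_def Field_omega_pow omega_pow_carrier_def)
    then show "prod_carrier ?Ws \<noteq> {}" by blast
  next
    fix x y assume "x \<in> prod_carrier ?Ws" "y \<in> prod_carrier ?Ws"
    then have xy: "x ! i \<in> Field (omega_pow (\<alpha>s ! i))" "y ! i \<in> Field (omega_pow (\<alpha>s ! i))"
      if "i < length \<alpha>s" for i
      using that by (auto simp: prod_carrier_def)
    \<comment> \<open>A power with empty exponent contains only the zero function, so all
      coordinates but the first are constant.\<close>
    have eq: "x ! i = y ! i" if "1 \<le> i" "i < length \<alpha>s" for i
      using xy[OF that(2)] empty[OF that] unfolding Field_omega_pow omega_pow_carrier_def by auto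
    have 0: "0 < length \<alpha>s" using n_pos by linarith
    have "(x ! 0, y ! 0) \<in> omega_pow (\<alpha>s ! 0) \<or> (y ! 0, x ! 0) \<in> omega_pow (\<alpha>s ! 0)"
      using W[OF 0] xy[OF 0] refl[of "x ! 0" 0]
      unfolding well_order_on_def linear_order_on_def total_on_def by metis
    then show "\<not> incomparable (prod_le ?Ws) x y"
    proof
      assume l: "(x ! 0, y ! 0) \<in> omega_pow (\<alpha>s ! 0)"
      have "(x ! i, y ! i) \<in> omega_pow (\<alpha>s ! i)" if "i < length \<alpha>s" for i
        using l eq[of i] refl[OF xy(1)[OF that]] that by (cases "i = 0") auto
      then show ?thesis by (simp add: incomparable_def prod_le_def)
    next
      assume l: "(y ! 0, x ! 0) \<in> omega_pow (\<alpha>s ! 0)"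
      have "(y ! i, x ! i) \<in> omega_pow (\<alpha>s ! i)" if "i < length \<alpha>s" for i
        using l eq[of i] refl[OF xy(1)[OF that]] that by (cases "i = 0") auto
      then show ?thesis by (simp add: incomparable_def prod_le_def)
    qed
  qed
next
  fix \<sigma> :: "'b rel" and \<delta> :: "'c rel" and \<epsilon> :: "'d rel"
  assume nonzero: "\<not> (\<forall>i. 1 \<le> i \<and> i < length \<alpha>s \<longrightarrow> (\<alpha>s ! i, {} :: 'a rel) \<in> ordIso)"
  assume "is_nat_sum (tl \<alpha>s) \<sigma> \<and> Well_order \<delta> \<and> (ord_sum ord_one \<delta>, \<sigma>) \<in> ordIso \<and>
    is_nat_sum2 (hd \<alpha>s) \<delta> \<epsilon>"
  then have sum: "is_nat_sum (tl \<alpha>s) \<sigma>" and one: "(ord_sum ord_one \<delta>, \<sigma>) \<in> ordIso"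
    and sum2: "is_nat_sum [map_prod Inl Inl ` hd \<alpha>s, map_prod Inr Inr ` \<delta>] \<epsilon>"
    by (auto simp: is_nat_sum2_def)
  \<comment> \<open>One type receiving \<open>'a\<close>, \<open>'b\<close>, \<open>'c\<close> and
    \<open>'d\<close>, so that all ordinals involved have order types in a single index type and can
    be compared.\<close>
  let ?a = "\<lambda>x. Inl (Inl x) :: ('a + 'b) + ('c + 'd)"
  let ?b = "\<lambda>x. Inl (Inr x) :: ('a + 'b) + ('c + 'd)"
  let ?c = "\<lambda>x. Inr (Inl x) :: ('a + 'b) + ('c + 'd)"
  let ?d = "\<lambda>x. Inr (Inr x) :: ('a + 'b) + ('c + 'd)"
  have inj: "inj ?a" "inj ?b" "inj ?d" "inj (case_sum ?a ?c)"
    by (auto simp: inj_def split: sum.splits)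
  obtain t :: "(('a + 'b) + ('c + 'd)) ordinal_index multiset list" where t: "length t = length (tl \<alpha>s)"
    "\<And>i. i < length (tl \<alpha>s) \<Longrightarrow> ord_type (tl \<alpha>s ! i) (t ! i)" "ord_type \<sigma> (sum_list t)"
    using ord_type_nat_sum[OF sum inj(1,2)] by blast
  obtain u :: "(('a + 'b) + ('c + 'd)) ordinal_index multiset list" where u: "length u = 2"
    "ord_type (map_prod Inl Inl ` hd \<alpha>s :: ('a + 'c) rel) (u ! 0)"
    "ord_type (map_prod Inr Inr ` \<delta> :: ('a + 'c) rel) (u ! 1)" "ord_type \<epsilon> (sum_list u)"
    using ord_type_nat_sum[OF sum2 inj(4,3)] by (auto simp: numeral_2_eq_2 less_Suc_eq)
  \<comment> \<open>The first entry comes from the binary sum with \<open>\<delta>\<close>, the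
    remaining ones from the sum over the tail; after removing the \<open>Inl\<close> tags, they are
    the order types of the given ordinals.\<close>
  define a where "a = u ! 0 # t"
  define d where "d = u ! 1"
  have len: "length a = length \<alpha>s" using t(1) n_pos by (simp add: a_def)
  have hd: "ord_type (hd \<alpha>s) (u ! 0)" using ord_type_inj_image[OF _ u(2)] by simp
  have ot: "ord_type (\<alpha>s ! i) (a ! i)" if "i < length a" for i
  proof (cases i)
    case 0
    then show ?thesis using hd n_pos by (simp add: a_def hd_conv_nth[symmetric] Suc_le_eq)
  next
    case (Suc k)
    then show ?thesis using t(2)[of k] that len by (simp add: a_def nth_tl)
  qed
  have "ord_type \<delta> d" using ord_type_inj_image[OF _ u(3)] by (simp add: d_def)
  \<comment> \<open>Both sides are order types of the isomorphic relations
    \<open>ord_sum ord_one \<delta>\<close> and \<open>\<sigma>\<close>, hence equal.\<close>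
  then have "sum_list t = one_plus d"
    using ord_type_unique[OF one ord_type_one_plus t(3)] by simp
  then have tl: "sum_list (tl a) = one_plus d" by (simp add: a_def)
  have desc: "a ! i \<le> a ! 0" if "i < length a" for i
    using that
  proof (induction i)
    case (Suc i)
    have "a ! Suc i \<le> a ! i"
      using decr Suc.prems ot[of i] ot[of "Suc i"] len by (intro ord_type_mono[of "\<alpha>s ! Suc i" "\<alpha>s ! i"]) auto
    then show ?case using Suc by simp
  qed simp
  obtain i where i: "1 \<le> i" "i < length \<alpha>s" "(\<alpha>s ! i, {} :: 'a rel) \<notin> ordIso" using nonzero by blast
  have "a ! i \<noteq> {#}"
  proof
    assume "a ! i = {#}"
    then have "Field (\<alpha>s ! i) = {}" using ot[of i] i len by (auto simp: ord_type_def bij_betw_def lessThan_def)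
    then have "\<alpha>s ! i = {}" by (auto simp: Field_def)
    then show False using i wo ordIso_reflexive[of "\<alpha>s ! i"] by auto
  qed
  then have "width_exp a = u ! 0 + d"
    using width_exp_hd[of a i d] desc i len tl by (simp add: a_def)
  moreover have "sum_list u = u ! 0 + d"
  proof -
    obtain p q where "u = [p, q]" using u(1) by (auto simp: numeral_2_eq_2 length_Suc_conv)
    then show ?thesis by (simp add: d_def)
  qed
  ultimately have "ord_type \<epsilon> (width_exp a)" using u(4) by simp
  then show "width_is (prod_carrier (map omega_pow \<alpha>s)) (prod_le (map omega_pow \<alpha>s)) (omega_pow \<epsilon>)"
    using len ot by (intro width_is_prod_omega_pow) auto
qed

end
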